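(* In the secretary problem with advice from a binary classifier (setting in the context) with recall $p$ and specificity $p'$, $p,p'\in[\tfrac12,1]$, the optimal policy is a threshold policy with two thresholds $t_Y\le t_N$: from time $t_Y$ onwards it accepts the best secretary so far when the advice is $Y$, and from time $t_N$ onwards it accepts the best secretary so far regardless of the advice. Moreover $$\mathsf{OPT}(p,p')\ \ge\ \lim_{n\to\infty}\mathsf{Opt}(n,p,p')=\Big(\frac{1-p'}{p}\Big)^{(1-p')/p'}\cdot e^{p/p'-1/p'},$$ and the thresholds satisfy $t_Y = n\cdot\big(\frac{1-p'}{p}\big)^{1/p'}e^{p/p'-1/p'}$ and $t_N=n\cdot e^{p/p'-1/p'}$ up to lower-order terms as $n\to\infty$ (i.e. $t_Y/n$ and $t_N/n$ converge to these coefficients).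
   Context: Binary classifier setting: $n$ secretaries arrive; their ranks $(r_1,\dots,r_n)$ form a uniformly random permutation of $\{1,\dots,n\}$ (rank $n$ is best). Each secretary $i$ comes with a signal $s_i\in\{Y,N\}$, drawn independently given the ranks, with $\Pr[s_i=Y\mid r_i=n]=p$, $\Pr[s_i=N\mid r_i=n]=1-p$, and for $r<n$, $\Pr[s_i=Y\mid r_i=r]=1-p'$, $\Pr[s_i=N\mid r_i=r]=p'$. At time $i$ the algorithm observes the relative order of secretaries $1,\dots,i$ and the signals $s_1,\dots,s_i$, and irrevocably decides whether to select secretary $i$; it wins if it selects the secretary of rank $n$. $\mathsf{Opt}(n,p,p')$ denotes the maximum winning probability over all policies for $n$ secretaries, and $\mathsf{OPT}(p,p')=\inf_{n\ge1}\mathsf{Opt}(n,p,p')$. A threshold policy is given by $t:\{Y,N\}\to\{1,\dots,n\}$ and stops at the first $i$ such that secretary $i$ beats all earlier ones and $i\ge t(s_i)$; here $t_Y=t(Y)$, $t_N=t(N)$. *)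

theory Defs
  imports "HOL-Probability.Probability" "HOL-Combinatorics.Permutations"
begin

datatype signal = Y | N

definition signal_pmf :: "nat \<Rightarrow> real \<Rightarrow> real \<Rightarrow> nat \<Rightarrow> signal pmf" where
  "signal_pmf n p p' k =
     map_pmf (\<lambda>b. if b then Y else N) (bernoulli_pmf (if k = n then p else 1 - p'))"

text \<open>
  An instance is a pair \<open>(r, s)\<close>: secretary \<open>i \<in> {1..n}\<close> has rank \<open>r i\<close> (rank \<open>n\<close> is the
  best) and signal \<open>s i\<close>. Outside \<open>{1..n}\<close> both functions carry irrelevant default values.
\<close>

definition instance_pmf :: "nat \<Rightarrow> real \<Rightarrow> real \<Rightarrow> ((nat \<Rightarrow> nat) \<times> (nat \<Rightarrow> signal)) pmf" where
  "instance_pmf n p p' =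
     bind_pmf (pmf_of_set {r. r permutes {1..n}}) (\<lambda>r.
       map_pmf (\<lambda>s. (r, s)) (Pi_pmf {1..n} N (\<lambda>i. signal_pmf n p p' (r i))))"

text \<open>
  The relative order of secretaries \<open>1, \<dots>, i\<close>, encoded as the list of their relative ranks;
  relative rank \<open>i\<close> is the best among them.
\<close>

definition rel_order :: "(nat \<Rightarrow> nat) \<Rightarrow> nat \<Rightarrow> nat list" where
  "rel_order r i = map (\<lambda>j. card {k \<in> {1..i}. r k \<le> r j}) [1..<Suc i]"

definition signals_upto :: "(nat \<Rightarrow> signal) \<Rightarrow> nat \<Rightarrow> signal list" where
  "signals_upto s i = map s [1..<Suc i]"

text \<open>
  A policy maps what has been observed up to the current time (relative order and signals, both
  lists having the current time as their length) to the decision whether to select the secretary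
  who has just arrived.
\<close>

type_synonym policy = "nat list \<Rightarrow> signal list \<Rightarrow> bool"

definition accepts :: "policy \<Rightarrow> (nat \<Rightarrow> nat) \<Rightarrow> (nat \<Rightarrow> signal) \<Rightarrow> nat \<Rightarrow> bool" where
  "accepts \<pi> r s i \<longleftrightarrow> \<pi> (rel_order r i) (signals_upto s i)"

definition selects :: "nat \<Rightarrow> policy \<Rightarrow> (nat \<Rightarrow> nat) \<Rightarrow> (nat \<Rightarrow> signal) \<Rightarrow> nat \<Rightarrow> bool" where
  "selects n \<pi> r s i \<longleftrightarrow> i \<in> {1..n} \<and> accepts \<pi> r s i \<and> (\<forall>j\<in>{1..<i}. \<not> accepts \<pi> r s j)"

definition win_prob :: "nat \<Rightarrow> real \<Rightarrow> real \<Rightarrow> policy \<Rightarrow> real" where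
  "win_prob n p p' \<pi> =
     measure_pmf.prob (instance_pmf n p p') {(r, s). \<exists>i. selects n \<pi> r s i \<and> r i = n}"

definition optimal_policy :: "nat \<Rightarrow> real \<Rightarrow> real \<Rightarrow> policy \<Rightarrow> bool" where
  "optimal_policy n p p' \<pi> \<longleftrightarrow> (\<forall>\<pi>'. win_prob n p p' \<pi>' \<le> win_prob n p p' \<pi>)"

definition Opt :: "nat \<Rightarrow> real \<Rightarrow> real \<Rightarrow> real" where
  "Opt n p p' = (SUP \<pi>. win_prob n p p' \<pi>)"

definition OPT :: "real \<Rightarrow> real \<Rightarrow> real" where
  "OPT p p' = (INF n\<in>{1..}. Opt n p p')"

definition threshold_policy :: "(signal \<Rightarrow> nat) \<Rightarrow> policy" where
  "threshold_policy t ranks sigs \<longleftrightarrow>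
     (\<forall>x\<in>set (butlast ranks). x < last ranks) \<and> t (last sigs) \<le> length ranks"

definition optimal_thresholds :: "nat \<Rightarrow> real \<Rightarrow> real \<Rightarrow> (signal \<Rightarrow> nat) \<Rightarrow> bool" where
  "optimal_thresholds n p p' t \<longleftrightarrow>
     range t \<subseteq> {1..n} \<and> t Y \<le> t N \<and> optimal_policy n p p' (threshold_policy t)"

text \<open>
  Real powers of nonnegative bases with \<open>0\<^sup>0 = 1\<close>, whereas \<open>0 powr 0 = 0\<close>. This matters at
  \<open>p' = 1\<close>, where the factor with base and exponent \<open>0\<close> has to be read as \<open>1\<close>.
\<close>

definition rpow :: "real \<Rightarrow> real \<Rightarrow> real" where
  "rpow x a = (if a = 0 then 1 else x powr a)"

end

theory Submission
  imports Defs
begin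

text \<open>
  A policy that stops at time \<open>i\<close> wins iff the last of the first \<open>i\<close> secretaries is the best of
  them and all later ones are worse. Conditioned on the best secretary not having arrived yet, the
  past relative order is uniform and the past signals are independent noise. So the problem is one
  of optimal stopping under that uninformative law, with reward weighted by \<open>p\<close> or \<open>1 - p\<close>
  according to the current signal, and the past matters only through \<open>i\<close>. Writing \<open>w\<close> for the
  value of continuing after time \<open>i\<close>, a best-so-far secretary should be accepted iff
  \<open>(i / n) * p \<ge> (1 - p') * w\<close> for the signal \<open>Y\<close> and iff \<open>(i / n) * (1 - p) \<ge> p' * w\<close> for \<open>N\<close>;
  since \<open>w\<close> decreases in \<open>i\<close>, these are thresholds.

  The backward recursion for \<open>w\<close> is the Euler scheme of a differential equation whose solution \<open>v\<close>
  is explicit, decreasing and concave with \<open>- 1 \<le> v' \<le> 0\<close>. By concavity the scheme stays above \<open>v\<close>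
  and the local errors telescope, so \<open>v (i / n) \<le> w \<le> v (i / n) + 1 / n\<close>. At \<open>i = 0\<close> this gives the
  limit and the lower bound on every \<open>Opt n p p'\<close>. An optimal pair of thresholds must satisfy the
  acceptance inequalities at the thresholds and their negations (up to equality) one step earlier,
  which locates it within \<open>O(1 / n)\<close> of the points where \<open>v\<close> crosses the rewards.
\<close>

section \<open>Recursive structure of random instances\<close>

text \<open>Composed after a permutation \<open>r\<close> of \<open>{1..m}\<close>, which fixes
  \<open>Suc m\<close>, it gives a newcomer the rank \<open>c\<close> and moves the ranks from
  \<open>c\<close> on up by one, so \<open>r\<close> stays the relative order of the earlier
  secretaries.\<close>

definition last_rank_cycle :: "nat \<Rightarrow> nat \<Rightarrow> nat \<Rightarrow> nat" where
  "last_rank_cycle m c k = (if k = Suc m then c else if c \<le> k \<and> k \<le> m then Suc k else k)"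

lemma last_rank_cycle_permutes:
  assumes "c \<in> {1..Suc m}"
  shows "last_rank_cycle m c permutes {1..Suc m}"
proof (rule inj_imp_permutes)
  show "inj_on (last_rank_cycle m c) {1..Suc m}"
    using assms by (intro inj_onI) (auto simp: last_rank_cycle_def split: if_splits)
qed (use assms in \<open>auto simp: last_rank_cycle_def\<close>)

lemma permutes_not_in_last: "r permutes {1..m} \<Longrightarrow> r (Suc m) = Suc m"
  by (rule permutes_not_in) auto

text \<open>Injective because \<open>c\<close> can be read off at \<open>Suc m\<close> and the cycle
  cancelled; surjective by counting, as \<open>(m + 1) * m! = (m + 1)!\<close>.\<close>

lemma permutes_Suc_bij_betw:
  "bij_betw (\<lambda>(c, r). last_rank_cycle m c \<circ> r) ({1..Suc m} \<times> {r. r permutes {1..m}})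
     {r. r permutes {1..Suc m}}"
proof (rule bij_betw_imageI)
  let ?A = "{1..Suc m} \<times> {r. r permutes {1..m}}"
  let ?f = "\<lambda>(c, r). last_rank_cycle m c \<circ> r"
  show inj: "inj_on ?f ?A"
  proof (rule inj_onI, clarsimp)
    fix c r c' r'
    assume c: "Suc 0 \<le> c" "c \<le> Suc m" "Suc 0 \<le> c'" "c' \<le> Suc m"
      and r: "r permutes {Suc 0..m}" "r' permutes {Suc 0..m}"
      and eq: "last_rank_cycle m c \<circ> r = last_rank_cycle m c' \<circ> r'"
    have "c = c'"
      using fun_cong[OF eq, of "Suc m"] permutes_not_in_last[of r m] permutes_not_in_last[of r' m] r
      by (auto simp: last_rank_cycle_def)
    moreover have "inj (last_rank_cycle m c)"
      using last_rank_cycle_permutes[of c m] c by (auto intro: permutes_inj)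
    ultimately show "c = c' \<and> r = r'"
      using eq by (auto simp: fun_eq_iff inj_eq)
  qed
  have sub: "?f ` ?A \<subseteq> {r. r permutes {1..Suc m}}"
  proof clarsimp
    fix c r assume c: "Suc 0 \<le> c" "c \<le> Suc m" and r: "r permutes {Suc 0..m}"
    have "r permutes {Suc 0..Suc m}"
      using r by (rule permutes_subset) auto
    thus "last_rank_cycle m c \<circ> r permutes {Suc 0..Suc m}"
      using last_rank_cycle_permutes[of c m] c by (intro permutes_compose) auto
  qed
  have "card (?f ` ?A) = card {r. r permutes {1..Suc m}}"
    using inj by (simp add: card_image card_cartesian_product card_permutations)
  thus "?f ` ?A = {r. r permutes {1..Suc m}}"
    by (intro card_subset_eq finite_permutations sub) auto
qed

lemma pmf_of_set_permutes_Suc: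
  "pmf_of_set {r. r permutes {1..Suc m}} =
     bind_pmf (pmf_of_set {1..Suc m}) (\<lambda>c.
       map_pmf (\<lambda>r. last_rank_cycle m c \<circ> r) (pmf_of_set {r. r permutes {1..m}}))"
proof -
  have ne: "{r. r permutes {1..m}} \<noteq> {}"
    using permutes_id by blast
  have fin: "finite {r. r permutes {1..m}}"
    by (rule finite_permutations) simp
  have "pmf_of_set {r. r permutes {1..Suc m}} = map_pmf (\<lambda>(c, r). last_rank_cycle m c \<circ> r)
          (pmf_of_set ({1..Suc m} \<times> {r. r permutes {1..m}}))"
    using permutes_Suc_bij_betw[of m] ne fin
    by (intro map_pmf_of_set_bij_betw[symmetric]) auto
  also have "pmf_of_set ({1..Suc m} \<times> {r. r permutes {1..m}}) =
      pair_pmf (pmf_of_set {1..Suc m}) (pmf_of_set {r. r permutes {1..m}})"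
  proof (intro pmf_eqI, clarify)
    fix c r
    show "pmf (pmf_of_set ({1..Suc m} \<times> {r. r permutes {1..m}})) (c, r) =
        pmf (pair_pmf (pmf_of_set {1..Suc m}) (pmf_of_set {r. r permutes {1..m}})) (c, r)"
      using pmf_of_set[OF ne fin, of r] ne fin
      by (subst pmf_of_set) (auto simp: pmf_pair indicator_def card_cartesian_product field_simps)
  qed
  finally show ?thesis
    by (simp add: pair_pmf_def map_bind_pmf map_pmf_def bind_assoc_pmf bind_return_pmf o_def)
qed

definition bernoulli_signal :: "real \<Rightarrow> signal pmf" where
  "bernoulli_signal a = map_pmf (\<lambda>b. if b then Y else N) (bernoulli_pmf a)"

lemma signal_pmf_eq: "signal_pmf n p p' k = bernoulli_signal (if k = n then p else 1 - p')"
  by (simp add: signal_pmf_def bernoulli_signal_def)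

text \<open>A signal depends on a rank only through being the best. If \<open>c \<le> m\<close>, the
  best of the first \<open>m\<close> becomes the overall best and keeps recall \<open>p\<close>. If
  \<open>c = Suc m\<close>, none of the first \<open>m\<close> is, and recall \<open>1 - p'\<close>
  makes all their signals noise.\<close>

lemma Pi_pmf_signal_Suc:
  assumes r: "r permutes {1..m}" and c: "c \<in> {1..Suc m}"
  shows "Pi_pmf {1..Suc m} N (\<lambda>i. signal_pmf (Suc m) p p' ((last_rank_cycle m c \<circ> r) i)) =
    bind_pmf (Pi_pmf {1..m} N (\<lambda>i. signal_pmf m (if c = Suc m then 1 - p' else p) p' (r i)))
      (\<lambda>s. map_pmf (\<lambda>x. s(Suc m := x)) (bernoulli_signal (if c = Suc m then p else 1 - p')))"
proof -
  have r_le: "r i \<le> m \<and> r i \<noteq> Suc m" if "i \<in> {1..m}" for i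
    using permutes_in_image[OF r, of i] that by auto
  have last: "last_rank_cycle m c (r (Suc m)) = c"
    using permutes_not_in_last[OF r] by (simp add: last_rank_cycle_def)
  have "Pi_pmf {1..m} N (\<lambda>i. signal_pmf (Suc m) p p' ((last_rank_cycle m c \<circ> r) i)) =
    Pi_pmf {1..m} N (\<lambda>i. signal_pmf m (if c = Suc m then 1 - p' else p) p' (r i))"
    using r_le c by (intro Pi_pmf_cong refl) (force simp: last_rank_cycle_def signal_pmf_eq)
  moreover have "{1..Suc m} = insert (Suc m) {1..m}"
    by auto
  ultimately have "Pi_pmf {1..Suc m} N (\<lambda>i. signal_pmf (Suc m) p p' ((last_rank_cycle m c \<circ> r) i)) =
      bind_pmf (bernoulli_signal (if c = Suc m then p else 1 - p')) (\<lambda>x.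
        bind_pmf (Pi_pmf {1..m} N (\<lambda>i. signal_pmf m (if c = Suc m then 1 - p' else p) p' (r i)))
          (\<lambda>s. return_pmf (s(Suc m := x))))"
    using last by (simp add: Pi_pmf_insert' signal_pmf_eq del: fun_upd_apply)
  thus ?thesis
    by (subst (asm) bind_commute_pmf) (simp add: map_pmf_def)
qed

text \<open>
  Given that the last of \<open>m + 1\<close> secretaries is the best (\<open>c = m + 1\<close>), the first \<open>m\<close> follow
  \<open>instance_pmf m (1 - p') p'\<close>, where the signals carry no information.
\<close>

lemma instance_pmf_Suc:
  "instance_pmf (Suc m) p p' = bind_pmf (pmf_of_set {1..Suc m}) (\<lambda>c.
     bind_pmf (instance_pmf m (if c = Suc m then 1 - p' else p) p') (\<lambda>(r, s).
       map_pmf (\<lambda>x. (last_rank_cycle m c \<circ> r, s(Suc m := x)))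
         (bernoulli_signal (if c = Suc m then p else 1 - p'))))"
proof -
  have fin: "finite {r. r permutes {1..m}}" "{r. r permutes {1..m}} \<noteq> {}"
    using finite_permutations[of "{1..m}"] permutes_id by blast+
  show ?thesis
    unfolding instance_pmf_def pmf_of_set_permutes_Suc bind_assoc_pmf bind_map_pmf
    using fin
    by (intro bind_pmf_cong refl)
       (simp add: Pi_pmf_signal_Suc[simplified] map_bind_pmf pmf.map_comp o_def set_pmf_of_set del: fun_upd_apply)
qed

lemma finite_set_instance_pmf [simp]: "finite (set_pmf (instance_pmf n p p'))"
proof -
  have "finite {r. r permutes {1..n}}" "{r. r permutes {1..n}} \<noteq> {}"
    using finite_permutations[of "{1..n}"] permutes_id by blast+
  moreover have "finite (set_pmf (Pi_pmf {1..n} N (\<lambda>i. signal_pmf n p p' (r i))))" for r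
    by (auto simp: set_Pi_pmf signal_pmf_eq bernoulli_signal_def intro!: finite_PiE_dflt)
  ultimately show ?thesis
    by (auto simp: instance_pmf_def set_pmf_of_set)
qed

lemma set_instance_pmf_permutes: "(r, s) \<in> set_pmf (instance_pmf n p p') \<Longrightarrow> r permutes {1..n}"
proof -
  have "finite {r. r permutes {1..n}}" "{r. r permutes {1..n}} \<noteq> {}"
    using finite_permutations[of "{1..n}"] permutes_id by blast+
  thus "(r, s) \<in> set_pmf (instance_pmf n p p') \<Longrightarrow> r permutes {1..n}"
    by (auto simp: instance_pmf_def set_pmf_of_set)
qed

definition mean_signal :: "real \<Rightarrow> (signal \<Rightarrow> real) \<Rightarrow> real" where
  "mean_signal a g = a * g Y + (1 - a) * g N"

lemma expectation_bind_finite: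
  fixes h :: "'b \<Rightarrow> real"
  assumes "finite (set_pmf M)" "\<And>z. z \<in> set_pmf M \<Longrightarrow> finite (set_pmf (f z))"
  shows "measure_pmf.expectation (bind_pmf M f) h =
    measure_pmf.expectation M (\<lambda>z. measure_pmf.expectation (f z) h)"
  using assms
  by (subst pmf_expectation_bind[of "set_pmf M"], simp_all,
      subst integral_measure_pmf[of "set_pmf M"], simp_all)

lemma expectation_instance_Suc:
  assumes "0 \<le> p" "p \<le> 1" "0 \<le> p'" "p' \<le> 1"
  shows "measure_pmf.expectation (instance_pmf (Suc m) p p') h =
    ((\<Sum>c\<in>{1..m}. measure_pmf.expectation (instance_pmf m p p') (\<lambda>(r, s).
        mean_signal (1 - p') (\<lambda>x. h (last_rank_cycle m c \<circ> r, s(Suc m := x))))) +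
     measure_pmf.expectation (instance_pmf m (1 - p') p') (\<lambda>(r, s).
        mean_signal p (\<lambda>x. h (last_rank_cycle m (Suc m) \<circ> r, s(Suc m := x))))) / Suc m"
proof -
  have sig: "measure_pmf.expectation (bernoulli_signal a) g = mean_signal a g"
    if "0 \<le> a" "a \<le> 1" for a and g :: "signal \<Rightarrow> real"
    using that by (simp add: bernoulli_signal_def mean_signal_def)
  have fin: "finite (set_pmf (map_pmf g (bernoulli_signal a)))"
    for a and g :: "signal \<Rightarrow> (nat \<Rightarrow> nat) \<times> (nat \<Rightarrow> signal)"
    by (simp add: bernoulli_signal_def)
  define F where "F c = bind_pmf (instance_pmf m (if c = Suc m then 1 - p' else p) p') (\<lambda>(r, s).
       map_pmf (\<lambda>x. (last_rank_cycle m c \<circ> r, s(Suc m := x)))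
         (bernoulli_signal (if c = Suc m then p else 1 - p')))" for c
  have F: "measure_pmf.expectation (F c) h =
      measure_pmf.expectation (instance_pmf m (if c = Suc m then 1 - p' else p) p') (\<lambda>(r, s).
        mean_signal (if c = Suc m then p else 1 - p')
          (\<lambda>x. h (last_rank_cycle m c \<circ> r, s(Suc m := x))))" for c
    unfolding F_def using fin
    by (subst expectation_bind_finite) (auto intro!: Bochner_Integration.integral_cong simp: sig assms)
  have finF: "finite (set_pmf (F c))" for c
    using fin by (auto simp: F_def)
  have eq: "instance_pmf (Suc m) p p' = bind_pmf (pmf_of_set {1..Suc m}) F"
    unfolding F_def by (rule instance_pmf_Suc)
  have "measure_pmf.expectation (instance_pmf (Suc m) p p') h =
      (\<Sum>c\<in>{1..Suc m}. measure_pmf.expectation (F c) h) / Suc m"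
    unfolding eq using finF
    by (subst pmf_expectation_bind_pmf_of_set) (simp_all add: sum_divide_distrib divide_inverse_commute sum_distrib_left distrib_left)
  also have "(\<Sum>c\<in>{1..Suc m}. measure_pmf.expectation (F c) h) =
      (\<Sum>c\<in>{1..m}. measure_pmf.expectation (F c) h) + measure_pmf.expectation (F (Suc m)) h"
    by simp
  also have "(\<Sum>c\<in>{1..m}. measure_pmf.expectation (F c) h) =
      (\<Sum>c\<in>{1..m}. measure_pmf.expectation (instance_pmf m p p') (\<lambda>(r, s).
        mean_signal (1 - p') (\<lambda>x. h (last_rank_cycle m c \<circ> r, s(Suc m := x)))))"
    by (intro sum.cong refl) (auto simp: F)
  finally show ?thesis
    by (simp add: F)
qed


section \<open>Observations and decisions after inserting a newcomer\<close>

lemma rel_order_insert: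
  assumes r: "r permutes {1..m}" and c: "c \<in> {1..Suc m}" and i: "i \<le> m"
  shows "rel_order (last_rank_cycle m c \<circ> r) i = rel_order r i"
proof -
  \<comment> \<open>The cycle is strictly increasing on \<open>{1..m}\<close>.\<close>
  have "last_rank_cycle m c (r k) \<le> last_rank_cycle m c (r j) \<longleftrightarrow> r k \<le> r j"
    if "k \<in> {1..i}" "j \<in> {1..i}" for k j
  proof -
    have "r k \<in> {1..m}" "r j \<in> {1..m}"
      using permutes_in_image[OF r] that i by auto
    thus ?thesis
      by (auto simp: last_rank_cycle_def)
  qed
  hence eq: "{k \<in> {1..i}. last_rank_cycle m c (r k) \<le> last_rank_cycle m c (r j)} =
      {k \<in> {1..i}. r k \<le> r j}" if "j \<in> {1..i}" for j
    using that by blast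
  show ?thesis
    unfolding rel_order_def o_apply
    by (intro map_cong refl arg_cong[where f = card] eq) auto
qed

lemma accepts_insert:
  assumes "r permutes {1..m}" "c \<in> {1..Suc m}" "i \<le> m"
  shows "accepts \<pi> (last_rank_cycle m c \<circ> r) (s(Suc m := x)) i = accepts \<pi> r s i"
  using assms by (auto simp: accepts_def rel_order_insert signals_upto_def intro!: arg_cong[of _ _ "\<pi> _"])

text \<open>At the final time all ranks \<open>1, ..., Suc m\<close> are present, so exactly
  \<open>v\<close> of them are at most \<open>v\<close> and relative ranks are ranks.\<close>

lemma rel_order_last:
  assumes r: "r permutes {1..m}" and c: "c \<in> {1..Suc m}"
  shows "rel_order (last_rank_cycle m c \<circ> r) (Suc m) =
     map (last_rank_cycle m c \<circ> r) [1..<Suc m] @ [c]"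
proof -
  let ?r = "last_rank_cycle m c \<circ> r"
  have per: "?r permutes {1..Suc m}"
    using permutes_subset[OF r] last_rank_cycle_permutes[OF c] by (intro permutes_compose) auto
  have "card {k \<in> {1..Suc m}. ?r k \<le> ?r j} = ?r j" if "j \<in> {1..Suc m}" for j
  proof -
    have "?r j \<le> Suc m"
      using permutes_in_image[OF per, of j] that by auto
    hence "{k \<in> {1..Suc m}. ?r k \<le> ?r j} = inv ?r ` {1..?r j}"
      using permutes_in_image[OF per] permutes_in_image[OF permutes_inv[OF per]]
        permutes_inverses[OF per]
      by (auto simp: image_iff) (metis atLeastAtMost_iff One_nat_def comp_apply order.trans)+
    moreover have "inj (inv ?r)"
      using permutes_inv[OF per] by (rule permutes_inj)
    ultimately show ?thesis
      by (simp add: card_image inj_on_subset)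
  qed
  hence "rel_order ?r (Suc m) = map ?r [1..<Suc (Suc m)]"
    unfolding rel_order_def by (intro map_cong refl) auto
  thus ?thesis
    using permutes_not_in_last[OF r] by (simp add: last_rank_cycle_def)
qed

lemma accepts_threshold_insert:
  assumes r: "r permutes {1..m}" and c: "c \<in> {1..Suc m}"
  shows "accepts (threshold_policy t) (last_rank_cycle m c \<circ> r) (s(Suc m := x)) (Suc m) \<longleftrightarrow>
    c = Suc m \<and> t x \<le> Suc m"
proof -
  have "(\<forall>j\<in>{1..m}. last_rank_cycle m c (r j) < c) \<longleftrightarrow> c = Suc m"
  proof
    assume *: "\<forall>j\<in>{1..m}. last_rank_cycle m c (r j) < c"
    show "c = Suc m"
    proof (rule ccontr)
      assume "c \<noteq> Suc m"
      hence "m \<in> {1..m}" using c by auto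
      \<comment> \<open>The former best is shifted to rank \<open>Suc m\<close>, above
        \<open>c\<close>.\<close>
      then obtain j where "j \<in> {1..m}" "r j = m"
        using permutes_image[OF r] by (metis imageE)
      thus False
        using * c \<open>c \<noteq> Suc m\<close> by (force simp: last_rank_cycle_def)
    qed
  next
    assume "c = Suc m"
    moreover have "r j \<in> {1..m}" if "j \<in> {1..m}" for j
      using permutes_in_image[OF r] that by blast
    ultimately show "\<forall>j\<in>{1..m}. last_rank_cycle m c (r j) < c"
      by (force simp: last_rank_cycle_def)
  qed
  moreover have "last (signals_upto (s(Suc m := x)) (Suc m)) = x"
    by (simp add: signals_upto_def)
  ultimately show ?thesis
    using rel_order_last[OF r c]
    by (auto simp: accepts_def threshold_policy_def atLeastLessThanSuc_atLeastAtMost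
        butlast_append simp del: upt_Suc)
qed

section \<open>Winning and rejecting everyone\<close>

definition wins :: "nat \<Rightarrow> policy \<Rightarrow> (nat \<Rightarrow> nat) \<Rightarrow> (nat \<Rightarrow> signal) \<Rightarrow> bool" where
  "wins n \<pi> r s \<longleftrightarrow> (\<exists>i. selects n \<pi> r s i \<and> r i = n)"

definition passes :: "nat \<Rightarrow> policy \<Rightarrow> (nat \<Rightarrow> nat) \<Rightarrow> (nat \<Rightarrow> signal) \<Rightarrow> bool" where
  "passes n \<pi> r s \<longleftrightarrow> (\<forall>j\<in>{1..n}. \<not> accepts \<pi> r s j)"

lemma passes_insert:
  assumes "r permutes {1..m}" "c \<in> {1..Suc m}"
  shows "passes (Suc m) \<pi> (last_rank_cycle m c \<circ> r) (s(Suc m := x)) \<longleftrightarrow>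
    passes m \<pi> r s \<and> \<not> accepts \<pi> (last_rank_cycle m c \<circ> r) (s(Suc m := x)) (Suc m)"
proof -
  have "{1..Suc m} = insert (Suc m) {1..m}" by auto
  thus ?thesis
    using accepts_insert[OF assms] by (auto simp: passes_def simp del: fun_upd_apply)
qed

lemma selects_insert:
  assumes "r permutes {1..m}" "c \<in> {1..Suc m}" "i \<le> m"
  shows "selects (Suc m) \<pi> (last_rank_cycle m c \<circ> r) (s(Suc m := x)) i \<longleftrightarrow> selects m \<pi> r s i"
  using accepts_insert[OF assms(1,2)] assms(3) by (auto simp: selects_def simp del: fun_upd_apply)

text \<open>For \<open>c \<le> m\<close> the newcomer is not the best, and the earlier secretary of
  rank \<open>m\<close> is the one moved to rank \<open>Suc m\<close>.\<close>

lemma wins_insert_less: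
  assumes r: "r permutes {1..m}" and c: "c \<in> {1..m}"
  shows "wins (Suc m) \<pi> (last_rank_cycle m c \<circ> r) (s(Suc m := x)) \<longleftrightarrow> wins m \<pi> r s"
proof -
  have "selects (Suc m) \<pi> (last_rank_cycle m c \<circ> r) (s(Suc m := x)) i \<and>
        (last_rank_cycle m c \<circ> r) i = Suc m \<longleftrightarrow> selects m \<pi> r s i \<and> r i = m" for i
  proof (cases "i \<in> {1..m}")
    case True
    hence "r i \<in> {1..m}"
      using permutes_in_image[OF r] by blast
    thus ?thesis
      using selects_insert[OF r, of c i \<pi> s x] True c by (auto simp: last_rank_cycle_def)
  next
    case False
    thus ?thesis
      using permutes_not_in_last[OF r] c
      by (cases "i = Suc m") (auto simp: selects_def last_rank_cycle_def)
  qed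
  thus ?thesis
    by (simp add: wins_def)
qed

lemma wins_insert_best:
  assumes r: "r permutes {1..m}"
  shows "wins (Suc m) \<pi> (last_rank_cycle m (Suc m) \<circ> r) (s(Suc m := x)) \<longleftrightarrow>
    passes m \<pi> r s \<and> accepts \<pi> (last_rank_cycle m (Suc m) \<circ> r) (s(Suc m := x)) (Suc m)"
proof -
  let ?r = "last_rank_cycle m (Suc m) \<circ> r"
  have eq: "?r i = Suc m \<longleftrightarrow> i = Suc m" if "i \<in> {1..Suc m}" for i
    using permutes_in_image[OF r, of i] permutes_not_in_last[OF r] that
    by (cases "i = Suc m") (auto simp: last_rank_cycle_def)
  hence "wins (Suc m) \<pi> ?r (s(Suc m := x)) \<longleftrightarrow> selects (Suc m) \<pi> ?r (s(Suc m := x)) (Suc m)"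
    by (auto simp: wins_def selects_def simp del: fun_upd_apply o_apply)
  also have "\<dots> \<longleftrightarrow> passes m \<pi> r s \<and> accepts \<pi> ?r (s(Suc m := x)) (Suc m)"
    using accepts_insert[OF r, of "Suc m"]
    by (auto simp: selects_def passes_def atLeastLessThanSuc_atLeastAtMost simp del: fun_upd_apply)
  finally show ?thesis .
qed

lemma win_prob_eq:
  "win_prob n p p' \<pi> =
    measure_pmf.expectation (instance_pmf n p p') (\<lambda>(r, s). of_bool (wins n \<pi> r s))"
proof -
  have "win_prob n p p' \<pi> = measure_pmf.expectation (instance_pmf n p p')
      (indicator {(r, s). wins n \<pi> r s})"
    by (simp add: win_prob_def wins_def)
  also have "(indicator {(r, s). wins n \<pi> r s} :: _ \<Rightarrow> real) = (\<lambda>(r, s). of_bool (wins n \<pi> r s))"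
    by (auto simp: indicator_def fun_eq_iff)
  finally show ?thesis .
qed

text \<open>Recall \<open>1 - p'\<close> is used because, as long as the overall best is yet to
  come, the signals seen so far are pure noise.\<close>

definition pass_prob :: "nat \<Rightarrow> real \<Rightarrow> policy \<Rightarrow> real" where
  "pass_prob n p' \<pi> =
    measure_pmf.expectation (instance_pmf n (1 - p') p') (\<lambda>(r, s). of_bool (passes n \<pi> r s))"

lemma expectation_instance_cong:
  assumes "\<And>r s. r permutes {1..n} \<Longrightarrow> f r s = g r s"
  shows "measure_pmf.expectation (instance_pmf n p p') (\<lambda>(r, s). f r s) =
    measure_pmf.expectation (instance_pmf n p p') (\<lambda>(r, s). g r s)"
  by (intro integral_cong_AE AE_pmfI) (auto dest!: set_instance_pmf_permutes simp: assms)

text \<open>Split by the newcomer's rank \<open>c\<close>. Each of the \<open>m\<close> cases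
  \<open>c \<le> m\<close> leaves the win to the first \<open>m\<close>; for
  \<open>c = Suc m\<close> the newcomer must be accepted after all others were rejected under the
  noise law.\<close>

lemma win_prob_Suc:
  assumes "0 \<le> p" "p \<le> 1" "0 \<le> p'" "p' \<le> 1"
  shows "Suc m * win_prob (Suc m) p p' \<pi> = m * win_prob m p p' \<pi> +
    measure_pmf.expectation (instance_pmf m (1 - p') p') (\<lambda>(r, s).
      of_bool (passes m \<pi> r s) * mean_signal p (\<lambda>x.
        of_bool (accepts \<pi> (last_rank_cycle m (Suc m) \<circ> r) (s(Suc m := x)) (Suc m))))"
proof -
  have "measure_pmf.expectation (instance_pmf m p p') (\<lambda>(r, s).
        mean_signal (1 - p') (\<lambda>x. of_bool (wins (Suc m) \<pi> (last_rank_cycle m c \<circ> r) (s(Suc m := x)))))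
      = win_prob m p p' \<pi>" if "c \<in> {1..m}" for c
    unfolding win_prob_eq
    by (rule expectation_instance_cong, subst (1) wins_insert_less)
       (use that in \<open>auto simp: mean_signal_def wins_insert_less[simplified]\<close>)
  moreover have "measure_pmf.expectation (instance_pmf m (1 - p') p') (\<lambda>(r, s).
        mean_signal p (\<lambda>x. of_bool (wins (Suc m) \<pi> (last_rank_cycle m (Suc m) \<circ> r) (s(Suc m := x))))) =
      measure_pmf.expectation (instance_pmf m (1 - p') p') (\<lambda>(r, s).
      of_bool (passes m \<pi> r s) * mean_signal p (\<lambda>x.
        of_bool (accepts \<pi> (last_rank_cycle m (Suc m) \<circ> r) (s(Suc m := x)) (Suc m))))"
    by (rule expectation_instance_cong) (auto simp: mean_signal_def wins_insert_best[simplified])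
  ultimately show ?thesis
    unfolding win_prob_eq[of "Suc m"] by (subst expectation_instance_Suc) (use assms in auto)
qed

text \<open>With recall \<open>1 - p'\<close> the signal of the best follows the same law as all
  others, so both branches of the split merge into one sum over \<open>c\<close>.\<close>

lemma pass_prob_Suc:
  assumes "0 \<le> p'" "p' \<le> 1"
  shows "Suc m * pass_prob (Suc m) p' \<pi> =
    measure_pmf.expectation (instance_pmf m (1 - p') p') (\<lambda>(r, s).
      of_bool (passes m \<pi> r s) * (\<Sum>c\<in>{1..Suc m}. mean_signal (1 - p') (\<lambda>x.
        of_bool (\<not> accepts \<pi> (last_rank_cycle m c \<circ> r) (s(Suc m := x)) (Suc m)))))"
proof -
  have "Suc m * pass_prob (Suc m) p' \<pi> = (\<Sum>c\<in>{1..Suc m}.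
      measure_pmf.expectation (instance_pmf m (1 - p') p') (\<lambda>(r, s).
        mean_signal (1 - p') (\<lambda>x. of_bool (passes (Suc m) \<pi> (last_rank_cycle m c \<circ> r) (s(Suc m := x))))))"
    unfolding pass_prob_def by (subst expectation_instance_Suc) (use assms in auto)
  also have "\<dots> = (\<Sum>c\<in>{1..Suc m}.
      measure_pmf.expectation (instance_pmf m (1 - p') p') (\<lambda>(r, s).
        of_bool (passes m \<pi> r s) * mean_signal (1 - p') (\<lambda>x.
          of_bool (\<not> accepts \<pi> (last_rank_cycle m c \<circ> r) (s(Suc m := x)) (Suc m)))))"
    by (intro sum.cong refl expectation_instance_cong)
       (auto simp: mean_signal_def passes_insert[simplified] simp del: o_apply fun_upd_apply)
  also have "\<dots> = measure_pmf.expectation (instance_pmf m (1 - p') p') (\<lambda>z. \<Sum>c\<in>{1..Suc m}.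
      (case z of (r, s) \<Rightarrow> of_bool (passes m \<pi> r s) * mean_signal (1 - p') (\<lambda>x.
          of_bool (\<not> accepts \<pi> (last_rank_cycle m c \<circ> r) (s(Suc m := x)) (Suc m)))))"
    by (rule Bochner_Integration.integral_sum[symmetric])
       (auto intro!: integrable_measure_pmf_finite)
  finally show ?thesis
    by (simp add: sum_distrib_left case_prod_unfold distrib_left)
qed


section \<open>Backward induction\<close>

text \<open>
  \<open>continuation f n j\<close> is the value of an optimal stopping problem when \<open>j\<close> of the \<open>n\<close> secretaries
  have been rejected, provided that \<open>f i w\<close> is the value just before secretary \<open>i\<close> arrives if
  rejecting her is worth \<open>w\<close>.
\<close>

definition continuation :: "(nat \<Rightarrow> real \<Rightarrow> real) \<Rightarrow> nat \<Rightarrow> nat \<Rightarrow> real" where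
  "continuation f n j = foldr f [Suc j..<Suc n] 0"

lemma continuation_end [simp]: "continuation f n n = 0"
  by (simp add: continuation_def)

lemma continuation_step:
  "j < n \<Longrightarrow> continuation f n j = f (Suc j) (continuation f n (Suc j))"
  unfolding continuation_def by (subst upt_conv_Cons) auto

text \<open>The payoff at time \<open>m + 1\<close> if nobody was selected before:
  \<open>1 / n\<close> is the chance that the overall best arrives then, and \<open>w\<close> is
  collected on rejection, averaged over a uniform relative rank \<open>c\<close> and a noise
  signal.\<close>

definition one_step_gain ::
    "nat \<Rightarrow> real \<Rightarrow> real \<Rightarrow> policy \<Rightarrow> nat \<Rightarrow> real \<Rightarrow> (nat \<Rightarrow> nat) \<Rightarrow> (nat \<Rightarrow> signal) \<Rightarrow> real" where
  "one_step_gain n p p' \<pi> m w r s =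
     mean_signal p (\<lambda>x.
       of_bool (accepts \<pi> (last_rank_cycle m (Suc m) \<circ> r) (s(Suc m := x)) (Suc m))) / n +
     w / Suc m * (\<Sum>c\<in>{1..Suc m}. mean_signal (1 - p') (\<lambda>x.
       of_bool (\<not> accepts \<pi> (last_rank_cycle m c \<circ> r) (s(Suc m := x)) (Suc m))))"

text \<open>
  \<open>(m / n) * win_prob m p p' \<pi>\<close> is the probability that the best of the \<open>n\<close> secretaries is among
  the first \<open>m\<close> and is selected. Adding \<open>w * pass_prob m p' \<pi>\<close> accounts for the event that nobody
  has been selected yet.
\<close>

lemma potential_Suc:
  assumes "0 \<le> p" "p \<le> 1" "0 \<le> p'" "p' \<le> 1"
  shows "Suc m / n * win_prob (Suc m) p p' \<pi> + w * pass_prob (Suc m) p' \<pi> =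
    m / n * win_prob m p p' \<pi> + measure_pmf.expectation (instance_pmf m (1 - p') p')
      (\<lambda>(r, s). of_bool (passes m \<pi> r s) * one_step_gain n p p' \<pi> m w r s)"
proof -
  let ?E = "measure_pmf.expectation (instance_pmf m (1 - p') p')"
  let ?g = "\<lambda>(r, s). of_bool (passes m \<pi> r s) * mean_signal p (\<lambda>x.
        of_bool (accepts \<pi> (last_rank_cycle m (Suc m) \<circ> r) (s(Suc m := x)) (Suc m)))"
  let ?h = "\<lambda>(r, s). of_bool (passes m \<pi> r s) * (\<Sum>c\<in>{1..Suc m}. mean_signal (1 - p') (\<lambda>x.
        of_bool (\<not> accepts \<pi> (last_rank_cycle m c \<circ> r) (s(Suc m := x)) (Suc m))))"
  have "(\<lambda>(r, s). of_bool (passes m \<pi> r s) * one_step_gain n p p' \<pi> m w r s) =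
      (\<lambda>z. ?g z / n + w / Suc m * ?h z)"
    by (auto simp: fun_eq_iff one_step_gain_def algebra_simps simp del: sum.cl_ivl_Suc)
  moreover have "?E (\<lambda>z. ?g z / n + w / Suc m * ?h z) = ?E ?g / n + w / Suc m * ?E ?h"
    by (subst Bochner_Integration.integral_add) (auto intro!: integrable_measure_pmf_finite)
  moreover have "Suc m / n * win_prob (Suc m) p p' \<pi> = (m * win_prob m p p' \<pi> + ?E ?g) / n"
    using win_prob_Suc[OF assms, of m \<pi>] by (metis times_divide_eq_left)
  moreover have "pass_prob (Suc m) p' \<pi> = ?E ?h / Suc m"
    using pass_prob_Suc[OF assms(3,4), of m \<pi>] by (simp add: field_simps del: sum.cl_ivl_Suc)
  ultimately show ?thesis
    by (simp add: add_divide_distrib)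
qed

lemma pass_prob_0: "pass_prob 0 p' \<pi> = 1"
  by (simp add: pass_prob_def passes_def case_prod_unfold)

lemma expectation_passes:
  "measure_pmf.expectation (instance_pmf m (1 - p') p') (\<lambda>(r, s). of_bool (passes m \<pi> r s) * w) =
    w * pass_prob m p' \<pi>"
  by (simp add: pass_prob_def case_prod_unfold)

text \<open>The potential of \<open>potential_Suc\<close> with \<open>w = continuation f n m\<close>
  is constant in \<open>m\<close>. At \<open>m = n\<close> the continuation vanishes and only the
  winning probability is left.\<close>

lemma win_prob_eqI:
  assumes "0 \<le> p" "p \<le> 1" "0 \<le> p'" "p' \<le> 1" "n \<ge> 1"
    and gain: "\<And>m r s w. m < n \<Longrightarrow> r permutes {1..m} \<Longrightarrow> one_step_gain n p p' \<pi> m w r s = f (Suc m) w"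
  shows "win_prob n p p' \<pi> = continuation f n 0"
proof -
  have "m / n * win_prob m p p' \<pi> + continuation f n m * pass_prob m p' \<pi> = continuation f n 0"
    if "m \<le> n" for m
    using that
  proof (induction m)
    case 0
    show ?case by (simp add: pass_prob_0)
  next
    case (Suc m)
    have "measure_pmf.expectation (instance_pmf m (1 - p') p')
        (\<lambda>(r, s). of_bool (passes m \<pi> r s) * one_step_gain n p p' \<pi> m (continuation f n (Suc m)) r s) =
      measure_pmf.expectation (instance_pmf m (1 - p') p')
        (\<lambda>(r, s). of_bool (passes m \<pi> r s) * continuation f n m)"
      using Suc.prems gain by (intro expectation_instance_cong) (auto simp: continuation_step)
    thus ?case
      using Suc by (subst potential_Suc) (use assms expectation_passes in auto)
  qed
  from this[of n] show ?thesis
    using assms by simp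
qed

text \<open>Here the same potential does not increase. The gain is bounded only at the actual
  continuation value, so that its nonnegativity can be used in verifying the bound.\<close>

lemma win_prob_leI:
  assumes "0 \<le> p" "p \<le> 1" "0 \<le> p'" "p' \<le> 1" "n \<ge> 1"
    and gain: "\<And>m r s. m < n \<Longrightarrow> r permutes {1..m} \<Longrightarrow>
      one_step_gain n p p' \<pi> m (continuation f n (Suc m)) r s \<le> f (Suc m) (continuation f n (Suc m))"
  shows "win_prob n p p' \<pi> \<le> continuation f n 0"
proof -
  have "m / n * win_prob m p p' \<pi> + continuation f n m * pass_prob m p' \<pi> \<le> continuation f n 0"
    if "m \<le> n" for m
    using that
  proof (induction m)
    case 0
    show ?case by (simp add: pass_prob_0)
  next
    case (Suc m)
    have "measure_pmf.expectation (instance_pmf m (1 - p') p')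
        (\<lambda>(r, s). of_bool (passes m \<pi> r s) * one_step_gain n p p' \<pi> m (continuation f n (Suc m)) r s) \<le>
      measure_pmf.expectation (instance_pmf m (1 - p') p')
        (\<lambda>(r, s). of_bool (passes m \<pi> r s) * continuation f n m)"
      using Suc.prems gain
      by (intro integral_mono_AE integrable_measure_pmf_finite AE_pmfI)
         (auto simp: continuation_step dest!: set_instance_pmf_permutes)
    also have "\<dots> = continuation f n m * pass_prob m p' \<pi>"
      by (rule expectation_passes)
    finally show ?case
      using Suc by (subst potential_Suc) (use assms in auto)
  qed
  from this[of n] show ?thesis
    using assms by simp
qed

text \<open>Secretary \<open>j\<close> is best so far with probability \<open>1 / j\<close>, and
  then best overall with probability \<open>j / n\<close>. In the maxima for \<open>Y\<close> and
  \<open>N\<close>, accepting carries the signal weights of the overall best and rejecting carries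
  the noise weights.\<close>

definition optimal_step :: "nat \<Rightarrow> real \<Rightarrow> real \<Rightarrow> nat \<Rightarrow> real \<Rightarrow> real" where
  "optimal_step n p p' j w =
     (1 - 1 / j) * w + (max (j / n * p) ((1 - p') * w) + max (j / n * (1 - p)) (p' * w)) / j"

definition threshold_step ::
    "(signal \<Rightarrow> nat) \<Rightarrow> nat \<Rightarrow> real \<Rightarrow> real \<Rightarrow> nat \<Rightarrow> real \<Rightarrow> real" where
  "threshold_step t n p p' j w =
     (1 - 1 / j) * w + ((if t Y \<le> j then j / n * p else (1 - p') * w) +
       (if t N \<le> j then j / n * (1 - p) else p' * w)) / j"

lemma win_prob_threshold:
  assumes "0 \<le> p" "p \<le> 1" "0 \<le> p'" "p' \<le> 1" "n \<ge> 1"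
  shows "win_prob n p p' (threshold_policy t) = continuation (threshold_step t n p p') n 0"
proof (rule win_prob_eqI[OF assms])
  fix m w and r :: "nat \<Rightarrow> nat" and s :: "nat \<Rightarrow> signal"
  assume r: "r permutes {1..m}"
  note acc = accepts_threshold_insert[OF r]
  have "(\<Sum>c\<in>{1..m}. mean_signal (1 - p') (\<lambda>x.
       of_bool (\<not> accepts (threshold_policy t) (last_rank_cycle m c \<circ> r) (s(Suc m := x)) (Suc m)))) =
       (\<Sum>c\<in>{1..m}. 1)"
    by (intro sum.cong refl) (simp add: acc mean_signal_def del: o_apply fun_upd_apply)
  thus "one_step_gain n p p' (threshold_policy t) m w r s = threshold_step t n p p' (Suc m) w"
    using assms
    by (simp add: one_step_gain_def acc threshold_step_def mean_signal_def del: o_apply fun_upd_apply)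
       (simp add: divide_simps; simp add: algebra_simps)
qed

lemma optimal_step_nonneg:
  assumes "0 \<le> p" "p \<le> 1" "0 \<le> p'" "p' \<le> 1" "0 \<le> w"
  shows "0 \<le> optimal_step n p p' j w"
proof -
  have "0 \<le> (1 - 1 / j) * w" if "j \<noteq> 0"
    using assms that by (intro mult_nonneg_nonneg) auto
  moreover have "0 \<le> max (j / n * p) ((1 - p') * w)" "0 \<le> max (j / n * (1 - p)) (p' * w)"
    using assms by (auto simp: le_max_iff_disj)
  ultimately show ?thesis
    using assms by (cases "j = 0") (auto simp: optimal_step_def)
qed

lemma continuation_optimal_nonneg:
  assumes "0 \<le> p" "p \<le> 1" "0 \<le> p'" "p' \<le> 1" "j \<le> n"
  shows "0 \<le> continuation (optimal_step n p p') n j"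
  using assms(5)
  by (induction rule: inc_induct) (use assms in \<open>auto simp: continuation_step optimal_step_nonneg\<close>)

lemma win_prob_le_optimal:
  assumes "0 \<le> p" "p \<le> 1" "0 \<le> p'" "p' \<le> 1" "n \<ge> 1"
  shows "win_prob n p p' \<pi> \<le> continuation (optimal_step n p p') n 0"
proof (rule win_prob_leI[OF assms])
  fix m and r :: "nat \<Rightarrow> nat" and s :: "nat \<Rightarrow> signal"
  assume m: "m < n"
  define w where "w = continuation (optimal_step n p p') n (Suc m)"
  define a where "a x = (of_bool (accepts \<pi> (last_rank_cycle m (Suc m) \<circ> r) (s(Suc m := x)) (Suc m)) :: real)" for x
  have w: "0 \<le> w"
    unfolding w_def using m assms by (intro continuation_optimal_nonneg) auto
  \<comment> \<open>Accepting a newcomer with \<open>c \<le> m\<close> never wins. Bounding her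
    rejection probability by 1 can only raise the gain, as \<open>w \<ge> 0\<close>.\<close>
  have "(\<Sum>c\<in>{1..m}. mean_signal (1 - p') (\<lambda>x.
       of_bool (\<not> accepts \<pi> (last_rank_cycle m c \<circ> r) (s(Suc m := x)) (Suc m)))) \<le> (\<Sum>c\<in>{1..m}. 1)"
    using assms by (intro sum_mono) (auto simp: mean_signal_def)
  moreover have "mean_signal (1 - p') (\<lambda>x.
       of_bool (\<not> accepts \<pi> (last_rank_cycle m (Suc m) \<circ> r) (s(Suc m := x)) (Suc m))) =
       (1 - p') * (1 - a Y) + p' * (1 - a N)"
    by (simp add: mean_signal_def a_def)
  ultimately have "(\<Sum>c\<in>{1..Suc m}. mean_signal (1 - p') (\<lambda>x.
       of_bool (\<not> accepts \<pi> (last_rank_cycle m c \<circ> r) (s(Suc m := x)) (Suc m)))) \<le>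
      m + ((1 - p') * (1 - a Y) + p' * (1 - a N))"
    by (simp del: o_apply fun_upd_apply)
  hence "w / Suc m * (\<Sum>c\<in>{1..Suc m}. mean_signal (1 - p') (\<lambda>x.
       of_bool (\<not> accepts \<pi> (last_rank_cycle m c \<circ> r) (s(Suc m := x)) (Suc m)))) \<le>
      w / Suc m * (m + ((1 - p') * (1 - a Y) + p' * (1 - a N)))"
    using w by (intro mult_left_mono) auto
  hence "one_step_gain n p p' \<pi> m w r s \<le> (p * a Y + (1 - p) * a N) / n +
      w / Suc m * (m + ((1 - p') * (1 - a Y) + p' * (1 - a N)))"
    unfolding one_step_gain_def a_def mean_signal_def by simp
  also have "\<dots> = (1 - 1 / Suc m) * w +
      ((Suc m / n * p * a Y + (1 - p') * w * (1 - a Y)) +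
       (Suc m / n * (1 - p) * a N + p' * w * (1 - a N))) / Suc m"
    using assms by (simp add: divide_simps) (simp add: algebra_simps)
  \<comment> \<open>Since \<open>a x\<close> is 0 or 1, it picks one entry of each maximum.\<close>
  also have "\<dots> \<le> optimal_step n p p' (Suc m) w"
    unfolding optimal_step_def by (intro add_left_mono divide_right_mono add_mono) (auto simp: a_def)
  finally show "one_step_gain n p p' \<pi> m w r s \<le> optimal_step n p p' (Suc m) w" .
qed

section \<open>Concavity in difference form\<close>

text \<open>
  If \<open>v' = - g\<close> on \<open>{a..b}\<close>, this says that \<open>v\<close> is concave there; stated without derivatives it can
  be glued along adjacent intervals.
\<close>

definition secant_bounds :: "(real \<Rightarrow> real) \<Rightarrow> (real \<Rightarrow> real) \<Rightarrow> real \<Rightarrow> real \<Rightarrow> bool" where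
  "secant_bounds g v a b \<longleftrightarrow> (\<forall>x y. a \<le> x \<and> x \<le> y \<and> y \<le> b \<longrightarrow>
     g x * (y - x) \<le> v x - v y \<and> v x - v y \<le> g y * (y - x))"

lemma secant_boundsD:
  assumes "secant_bounds g v a b" "a \<le> x" "x \<le> y" "y \<le> b"
  shows "g x * (y - x) \<le> v x - v y" "v x - v y \<le> g y * (y - x)"
  using assms unfolding secant_bounds_def by blast+

lemma secant_bounds_mono:
  assumes "secant_bounds g v a b" "a \<le> x" "x \<le> y" "y \<le> b"
  shows "g x \<le> g y"
proof (cases "x = y")
  case False
  have "g x * (y - x) \<le> g y * (y - x)"
    using secant_boundsD[OF assms] by linarith
  thus ?thesis
    using False assms(3) by simp
qed simp

lemma secant_bounds_cong:
  assumes "secant_bounds g v a b" "\<And>x. x \<in> {a..b} \<Longrightarrow> g' x = g x" "\<And>x. x \<in> {a..b} \<Longrightarrow> v' x = v x"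
  shows "secant_bounds g' v' a b"
  using assms unfolding secant_bounds_def by auto

text \<open>For \<open>x \<le> b \<le> y\<close>, add the bounds on the two sides of
  \<open>b\<close>; monotonicity of \<open>g\<close> replaces \<open>g b\<close> by
  \<open>g x\<close> or \<open>g y\<close>.\<close>

lemma secant_bounds_glue:
  assumes ab: "secant_bounds g v a b" and bc: "secant_bounds g v b c"
  shows "secant_bounds g v a c"
  unfolding secant_bounds_def
proof (intro allI impI)
  fix x y assume xy: "a \<le> x \<and> x \<le> y \<and> y \<le> c"
  consider "y \<le> b" | "b \<le> x" | "x \<le> b" "b \<le> y" by linarith
  thus "g x * (y - x) \<le> v x - v y \<and> v x - v y \<le> g y * (y - x)"
  proof cases
    case 1
    thus ?thesis using secant_boundsD[OF ab, of x y] xy by auto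
  next
    case 2
    thus ?thesis using secant_boundsD[OF bc, of x y] xy by auto
  next
    case 3
    have "g x * (y - b) \<le> g b * (y - b)" "g b * (b - x) \<le> g y * (b - x)"
      using secant_bounds_mono[OF ab, of x b] secant_bounds_mono[OF bc, of b y] xy 3
      by (auto intro!: mult_right_mono)
    thus ?thesis
      using secant_boundsD[OF ab, of x b] secant_boundsD[OF bc, of b y] xy 3
      by (auto simp: algebra_simps)
  qed
qed

lemma secant_bounds_deriv:
  assumes deriv: "\<And>x. x \<in> {a..b} \<Longrightarrow> (v has_real_derivative - g x) (at x within {a..b})"
    and mono: "\<And>x y. a \<le> x \<Longrightarrow> x \<le> y \<Longrightarrow> y \<le> b \<Longrightarrow> g x \<le> g y"
  shows "secant_bounds g v a b"
  unfolding secant_bounds_def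
proof (intro allI impI)
  fix x y assume xy: "a \<le> x \<and> x \<le> y \<and> y \<le> b"
  show "g x * (y - x) \<le> v x - v y \<and> v x - v y \<le> g y * (y - x)"
  proof (cases "x = y")
    case False
    hence "x < y" using xy by simp
    hence "\<exists>z\<in>{x<..<y}. v y - v x = (- g z) * (y - x)"
    proof (rule mvt_simple)
      fix z assume z: "x \<le> z" "z \<le> y"
      have "(v has_real_derivative - g z) (at z within {x..y})"
        using deriv[of z] z xy by (auto elim!: has_field_derivative_subset)
      thus "(v has_derivative (*) (- g z)) (at z within {x..y})"
        by (simp add: has_field_derivative_def)
    qed
    then obtain z where z: "x < z" "z < y" "v x - v y = g z * (y - x)"
      by (auto simp: algebra_simps)
    have "g x \<le> g z" "g z \<le> g y"
      using mono[of x z] mono[of z y] z xy by auto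
    thus ?thesis
      using z xy by (auto intro!: mult_right_mono)
  qed simp
qed

section \<open>The limiting continuation value\<close>

locale binary_classifier =
  fixes p p' :: real
  assumes p_ge: "1/2 \<le> p" and p_le: "p \<le> 1" and p'_ge: "1/2 \<le> p'" and p'_le: "p' \<le> 1"
begin

definition yes_time :: real where
  "yes_time = rpow ((1 - p') / p) (1 / p') * exp (p / p' - 1 / p')"

definition no_time :: real where
  "no_time = exp (p / p' - 1 / p')"

definition limit_value :: real where
  "limit_value = rpow ((1 - p') / p) ((1 - p') / p') * exp (p / p' - 1 / p')"

text \<open>
  The limit of the continuation values as a function of the elapsed fraction of time: the solution
  of \<open>x * v' x + max (x * p - (1 - p') * v x) 0 + max (x * (1 - p) - p' * v x) 0 = 0\<close>, \<open>v 1 = 0\<close>.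
\<close>

definition limit_continuation :: "real \<Rightarrow> real" where
  "limit_continuation x =
     (if x \<le> yes_time then limit_value
      else if x \<le> no_time then x * ((no_time / x) powr p' - p) / p'
      else - x * ln x)"

text \<open>Minus the derivative of \<open>limit_continuation\<close> on \<open>(0, 1]\<close>; the
  pieces match at positive \<open>yes_time\<close> and at \<open>no_time\<close>. For
  \<open>p' = 1\<close> it jumps at \<open>0\<close>, and the value \<open>0\<close> there still
  respects monotonicity.\<close>

definition decay :: "real \<Rightarrow> real" where
  "decay x =
     (if x \<le> yes_time then 0
      else if x \<le> no_time then (p - (1 - p') * (no_time / x) powr p') / p'
      else 1 + ln x)"

lemma p_pos: "0 < p" and p'_pos: "0 < p'"
  using p_ge p'_ge by auto

lemma no_time_pos: "0 < no_time"
  by (simp add: no_time_def)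

lemma ln_no_time: "ln no_time = (p - 1) / p'"
  by (simp add: no_time_def diff_divide_distrib)

lemma no_time_le: "no_time \<le> 1"
  using p_le p'_pos by (simp add: no_time_def divide_right_mono)

lemma yes_time_nonneg: "0 \<le> yes_time"
  by (simp add: yes_time_def rpow_def)

lemma yes_time_eq: "yes_time = ((1 - p') / p) powr (1 / p') * no_time"
  using p'_pos by (simp add: yes_time_def no_time_def rpow_def)

lemma yes_time_le: "yes_time \<le> no_time"
proof -
  have "((1 - p') / p) powr (1 / p') \<le> 1"
    using p_ge p'_ge p'_le by (intro powr_le1) (auto simp: divide_simps)
  thus ?thesis
    using no_time_pos by (simp add: yes_time_eq)
qed

lemma yes_time_pos_iff: "0 < yes_time \<longleftrightarrow> p' < 1"
proof (cases "p' = 1")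
  case True
  thus ?thesis
    unfolding yes_time_def by (simp add: rpow_def)
next
  case False
  thus ?thesis
    using no_time_pos p_pos p'_le by (auto simp: yes_time_eq)
qed

lemma powr_yes_time:
  assumes "p' < 1"
  shows "(no_time / yes_time) powr p' = p / (1 - p')"
proof -
  have "no_time / yes_time = (p / (1 - p')) powr (1 / p')"
    using assms no_time_pos p_pos by (simp add: yes_time_eq powr_divide field_simps)
  thus ?thesis
    using p'_pos p_pos assms by (simp add: powr_powr)
qed

text \<open>Indifference between accepting and rejecting a \<open>Y\<close> at
  \<open>yes_time\<close>. It rests on \<open>1 / p' = 1 + (1 - p') / p'\<close>; for
  \<open>p' = 1\<close> both sides vanish.\<close>

lemma limit_value_cross: "p * yes_time = (1 - p') * limit_value"
proof (cases "p' = 1")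
  case False
  hence lt: "p' < 1" using p'_le by simp
  have "1 / p' = 1 + (1 - p') / p'"
    using p'_pos by (simp add: field_simps)
  hence "((1 - p') / p) powr (1 / p') = ((1 - p') / p) * ((1 - p') / p) powr ((1 - p') / p')"
    using lt p_pos by (metis powr_add powr_one divide_nonneg_pos diff_ge_0_iff_ge less_imp_le)
  thus ?thesis
    using lt p_pos p'_pos by (simp add: yes_time_eq limit_value_def rpow_def no_time_def)
qed (use yes_time_pos_iff yes_time_nonneg in auto)

lemma limit_continuation_low: "x \<le> yes_time \<Longrightarrow> limit_continuation x = limit_value"
  by (simp add: limit_continuation_def)

text \<open>The left and middle pieces agree at \<open>yes_time\<close> by
  \<open>limit_value_cross\<close>. The condition \<open>0 < x\<close> excludes
  \<open>x = yes_time = 0\<close>, which arises for \<open>p' = 1\<close>.\<close>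

lemma limit_continuation_mid:
  assumes "0 < x" "yes_time \<le> x" "x \<le> no_time"
  shows "limit_continuation x = x * ((no_time / x) powr p' - p) / p'"
proof (cases "x = yes_time")
  case True
  hence lt: "p' < 1" using assms yes_time_pos_iff by simp
  have "limit_value = p * yes_time / (1 - p')"
    using limit_value_cross lt by (simp add: field_simps)
  moreover have "yes_time * (p / (1 - p') - p) / p' = p * yes_time / (1 - p')"
    using lt p'_pos by (simp add: divide_simps) (simp add: algebra_simps)
  ultimately show ?thesis
    using powr_yes_time[OF lt] True by (simp add: limit_continuation_def)
qed (use assms in \<open>auto simp: limit_continuation_def\<close>)

lemma limit_continuation_no_time: "p' * limit_continuation no_time = (1 - p) * no_time"
  using limit_continuation_mid[OF no_time_pos yes_time_le] no_time_pos p'_pos by simp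

lemma limit_continuation_high:
  assumes "no_time \<le> x"
  shows "limit_continuation x = - x * ln x"
proof (cases "x = no_time")
  case True
  have "limit_continuation no_time = no_time * (1 - p) / p'"
    using limit_continuation_mid[OF no_time_pos yes_time_le] no_time_pos by simp
  thus ?thesis
    using True by (simp add: ln_no_time field_simps)
qed (use assms yes_time_le in \<open>auto simp: limit_continuation_def\<close>)

lemma decay_low: "x \<le> yes_time \<Longrightarrow> decay x = 0"
  by (simp add: decay_def)

lemma decay_mid:
  assumes "0 < x" "yes_time \<le> x" "x \<le> no_time"
  shows "decay x = (p - (1 - p') * (no_time / x) powr p') / p'"
proof (cases "x = yes_time")
  case True
  hence "p' < 1" using assms yes_time_pos_iff by simp
  thus ?thesis
    using True powr_yes_time by (simp add: decay_def)
qed (use assms in \<open>auto simp: decay_def\<close>)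

lemma decay_high:
  assumes "no_time \<le> x"
  shows "decay x = 1 + ln x"
proof (cases "x = no_time")
  case True
  have "decay no_time = (p - (1 - p')) / p'"
    using decay_mid[OF no_time_pos yes_time_le] no_time_pos by simp
  thus ?thesis
    using True p'_pos by (simp add: ln_no_time field_simps)
qed (use assms yes_time_le in \<open>auto simp: decay_def\<close>)

lemma secant_bounds_low: "secant_bounds decay limit_continuation 0 yes_time"
  by (auto simp: secant_bounds_def decay_low limit_continuation_low)

lemma secant_bounds_mid_pos:
  assumes "0 < a" "yes_time \<le> a"
  shows "secant_bounds decay limit_continuation a no_time"
proof (rule secant_bounds_cong)
  let ?v = "\<lambda>x. x * ((no_time / x) powr p' - p) / p'"
  let ?g = "\<lambda>x. (p - (1 - p') * (no_time / x) powr p') / p'"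
  show "secant_bounds ?g ?v a no_time"
  proof (rule secant_bounds_deriv)
    fix x assume "x \<in> {a..no_time}"
    hence "0 < x" using assms by auto
    thus "(?v has_real_derivative - ?g x) (at x within {a..no_time})"
      using no_time_pos p'_pos
      by (auto intro!: derivative_eq_intros simp: powr_diff field_simps power2_eq_square)
  next
    fix x y assume xy: "a \<le> x" "x \<le> y" "y \<le> no_time"
    have "(no_time / y) powr p' \<le> (no_time / x) powr p'"
      using xy assms no_time_pos p'_pos by (intro powr_mono2 divide_left_mono) auto
    thus "?g x \<le> ?g y"
      using p'_pos p'_le by (intro divide_right_mono diff_left_mono mult_left_mono) auto
  qed
qed (use assms in \<open>auto simp: decay_mid limit_continuation_mid\<close>)

text \<open>For \<open>p' = 1\<close> the middle piece starts at \<open>0\<close>, where its formula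
  divides by zero. There the function is affine, so the bounds are checked directly.\<close>

lemma secant_bounds_mid_perfect:
  assumes "p' = 1"
  shows "secant_bounds decay limit_continuation 0 no_time"
proof -
  have 0: "yes_time = 0"
    using yes_time_pos_iff yes_time_nonneg assms by auto
  have v: "limit_continuation x = no_time - p * x" if "0 \<le> x" "x \<le> no_time" for x
  proof (cases "x = 0")
    case True
    \<comment> \<open>Here the convention \<open>rpow 0 0 = 1\<close> enters.\<close>
    have "limit_value = no_time"
      unfolding limit_value_def no_time_def using assms by (simp add: rpow_def)
    thus ?thesis
      using True 0 by (simp add: limit_continuation_low)
  next
    case False
    thus ?thesis
      using that 0 assms no_time_pos by (subst limit_continuation_mid) (auto simp: field_simps)
  qed
  have g: "decay x = (if x = 0 then 0 else p)" if "0 \<le> x" "x \<le> no_time" for x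
    using that 0 assms decay_low[of x] decay_mid[of x] by auto
  show ?thesis
    unfolding secant_bounds_def
  proof (intro allI impI)
    fix x y assume "0 \<le> x \<and> x \<le> y \<and> y \<le> no_time"
    thus "decay x * (y - x) \<le> limit_continuation x - limit_continuation y \<and>
        limit_continuation x - limit_continuation y \<le> decay y * (y - x)"
      using p_pos by (auto simp: v g algebra_simps)
  qed
qed

lemma secant_bounds_high: "secant_bounds decay limit_continuation no_time 1"
proof (rule secant_bounds_cong)
  show "secant_bounds (\<lambda>x. 1 + ln x) (\<lambda>x. - x * ln x) no_time 1"
    using no_time_pos
    by (intro secant_bounds_deriv) (auto intro!: derivative_eq_intros)
qed (auto simp: decay_high limit_continuation_high)

lemma limit_continuation_secant: "secant_bounds decay limit_continuation 0 1"
proof (rule secant_bounds_glue[OF _ secant_bounds_high])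
  show "secant_bounds decay limit_continuation 0 no_time"
  proof (cases "p' = 1")
    case False
    hence "0 < yes_time" using yes_time_pos_iff p'_le by auto
    thus ?thesis
      by (intro secant_bounds_glue[OF secant_bounds_low] secant_bounds_mid_pos) auto
  qed (rule secant_bounds_mid_perfect)
qed

lemma decay_nonneg:
  assumes "0 \<le> x" "x \<le> 1"
  shows "0 \<le> decay x"
  using secant_bounds_mono[OF limit_continuation_secant, of 0 x] decay_low[OF yes_time_nonneg] assms
  by simp

lemma limit_continuation_antimono:
  assumes "0 \<le> x" "x \<le> y" "y \<le> 1"
  shows "limit_continuation y \<le> limit_continuation x"
proof -
  have "0 \<le> decay x * (y - x)"
    using decay_nonneg[of x] assms by auto
  thus ?thesis
    using secant_boundsD(1)[OF limit_continuation_secant assms] by linarith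
qed

lemma yes_cross_low:
  assumes "0 \<le> x" "x \<le> yes_time"
  shows "x * p \<le> (1 - p') * limit_continuation x"
  using mult_right_mono[OF assms(2), of p] p_pos limit_value_cross limit_continuation_low[OF assms(2)]
  by (simp add: mult.commute)

text \<open>The continuation decreases while the reward grows with slope \<open>p\<close>. The
  surplus term later turns an error in the value into an error in the threshold.\<close>

lemma yes_cross_high:
  assumes "yes_time \<le> x" "x \<le> 1"
  shows "(1 - p') * limit_continuation x + p * (x - yes_time) \<le> x * p"
proof -
  have "limit_continuation x \<le> limit_value"
    using limit_continuation_antimono[of yes_time x] assms yes_time_nonneg
      limit_continuation_low[of yes_time] by auto
  hence "(1 - p') * limit_continuation x \<le> p * yes_time"
    unfolding limit_value_cross using p'_le by (intro mult_left_mono) auto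
  thus ?thesis
    by (simp add: algebra_simps)
qed

lemma no_cross_low:
  assumes "0 \<le> x" "x \<le> no_time"
  shows "x * (1 - p) \<le> p' * limit_continuation x"
proof -
  have "p' * limit_continuation no_time \<le> p' * limit_continuation x"
    using assms no_time_le p'_pos by (intro mult_left_mono limit_continuation_antimono) auto
  moreover have "x * (1 - p) \<le> no_time * (1 - p)"
    using assms p_le by (intro mult_right_mono) auto
  ultimately show ?thesis
    using limit_continuation_no_time by (simp add: mult.commute)
qed

lemma no_cross_high:
  assumes "no_time \<le> x" "x \<le> 1"
  shows "p' * limit_continuation x + (1 - p) * (x - no_time) \<le> x * (1 - p)"
proof -
  have "p' * limit_continuation x \<le> p' * limit_continuation no_time"
    using assms no_time_pos p'_pos by (intro mult_left_mono limit_continuation_antimono) auto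
  thus ?thesis
    unfolding limit_continuation_no_time by (simp add: algebra_simps)
qed

text \<open>The differential equation for the limit. On each piece the crossing lemmas tell which
  maxima are active.\<close>

lemma decay_eq:
  assumes "0 < x" "x \<le> 1"
  shows "x * decay x = max (x * p - (1 - p') * limit_continuation x) 0 +
    max (x * (1 - p) - p' * limit_continuation x) 0"
proof -
  consider "x \<le> yes_time" | "yes_time \<le> x" "x \<le> no_time" | "no_time \<le> x"
    by linarith
  thus ?thesis
  proof cases
    case 1
    thus ?thesis
      using yes_cross_low[of x] no_cross_low[of x] yes_time_le assms by (simp add: decay_low)
  next
    case 2
    have "0 \<le> p * (x - yes_time)" using p_pos 2 by simp
    hence "(1 - p') * limit_continuation x \<le> x * p"
      using yes_cross_high[of x] 2 assms by linarith
    thus ?thesis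
      using no_cross_low[of x] 2 assms p'_pos
      by (simp add: decay_mid limit_continuation_mid) (simp add: field_simps)
  next
    case 3
    have "0 \<le> p * (x - yes_time)" "0 \<le> (1 - p) * (x - no_time)"
      using p_pos p_le 3 yes_time_le by auto
    hence "(1 - p') * limit_continuation x \<le> x * p" "p' * limit_continuation x \<le> x * (1 - p)"
      using yes_cross_high[of x] no_cross_high[of x] 3 yes_time_le assms by linarith+
    thus ?thesis
      using 3 by (simp add: decay_high limit_continuation_high algebra_simps)
  qed
qed

lemma limit_continuation_1: "limit_continuation 1 = 0"
  using limit_continuation_high[OF no_time_le] by simp

lemma decay_1: "decay 1 = 1"
  using decay_high[OF no_time_le] by simp

lemma limit_value_pos: "0 < limit_value"
  using p_pos p'_pos p'_le by (auto simp: limit_value_def rpow_def)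

text \<open>Strictness rules out indifference before \<open>no_time\<close>. For
  \<open>p = 1\<close> the left side is \<open>0\<close>, and positivity of the continuation before
  \<open>no_time = 1\<close> is what remains.\<close>

lemma no_cross_less:
  assumes "0 < x" "x < no_time"
  shows "x * (1 - p) < p' * limit_continuation x"
proof (cases "p = 1")
  case False
  have "p' * limit_continuation no_time \<le> p' * limit_continuation x"
    using assms no_time_le p'_pos by (intro mult_left_mono limit_continuation_antimono) auto
  moreover have "x * (1 - p) < no_time * (1 - p)"
    using assms p_le False by (intro mult_strict_right_mono) auto
  ultimately show ?thesis
    using limit_continuation_no_time by (simp add: mult.commute)
next
  case True
  have "0 < limit_continuation x"
  proof (cases "x \<le> yes_time")
    case False
    have "1 < (no_time / x) powr p'"
      using assms p'_pos by (intro gr_one_powr) auto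
    hence "p < (no_time / x) powr p'"
      using p_le by linarith
    thus ?thesis
      using False assms p'_pos by (simp add: limit_continuation_mid)
  qed (simp add: limit_continuation_low limit_value_pos)
  thus ?thesis
    using True p'_pos by simp
qed

section \<open>Convergence of the continuation values\<close>

lemma optimal_step_mono:
  assumes "w \<le> w'" "1 \<le> j"
  shows "optimal_step n p p' j w \<le> optimal_step n p p' j w'"
proof -
  have "(1 - p') * w \<le> (1 - p') * w'" "p' * w \<le> p' * w'" "(1 - 1 / j) * w \<le> (1 - 1 / j) * w'"
    using assms p'_le p'_pos by (auto intro!: mult_left_mono)
  thus ?thesis
    unfolding optimal_step_def by (intro add_mono divide_right_mono max.mono) auto
qed

text \<open>The coefficients of \<open>w\<close> add up to at most
  \<open>(1 - 1 / j) + ((1 - p') + p') / j = 1\<close>, so errors are not amplified.\<close>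

lemma optimal_step_add_le:
  assumes "0 \<le> d" "1 \<le> j"
  shows "optimal_step n p p' j (w + d) \<le> optimal_step n p p' j w + d"
proof -
  have "0 \<le> (1 - p') * d" "0 \<le> p' * d"
    using assms p'_le p'_pos by auto
  hence "max (j / n * p) ((1 - p') * (w + d)) + max (j / n * (1 - p)) (p' * (w + d)) \<le>
      max (j / n * p) ((1 - p') * w) + max (j / n * (1 - p)) (p' * w) + d"
    by (auto simp: algebra_simps max_def)
  hence "(max (j / n * p) ((1 - p') * (w + d)) + max (j / n * (1 - p)) (p' * (w + d))) / j \<le>
      (max (j / n * p) ((1 - p') * w) + max (j / n * (1 - p)) (p' * w) + d) / j"
    by (rule divide_right_mono) simp
  thus ?thesis
    unfolding optimal_step_def by (simp add: algebra_simps add_divide_distrib)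
qed

text \<open>Rejecting under both signals is always possible and preserves \<open>w\<close>.\<close>

lemma optimal_step_ge:
  assumes "1 \<le> j"
  shows "w \<le> optimal_step n p p' j w"
proof -
  have "((1 - p') * w + p' * w) / j \<le>
      (max (j / n * p) ((1 - p') * w) + max (j / n * (1 - p)) (p' * w)) / j"
    by (intro divide_right_mono add_mono) auto
  thus ?thesis
    unfolding optimal_step_def by (simp add: algebra_simps)
qed

text \<open>By \<open>decay_eq\<close> and \<open>max a b = b + max (a - b) 0\<close>, the recursion
  performs an Euler step of size \<open>1 / n\<close>.\<close>

lemma optimal_step_limit_continuation:
  assumes "1 \<le> j" "j \<le> n"
  shows "optimal_step n p p' j (limit_continuation (j / n)) =
    limit_continuation (j / n) + decay (j / n) / n"
proof -
  let ?x = "real j / n" and ?v = "limit_continuation (j / n)"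
  have "max (?x * p) ((1 - p') * ?v) + max (?x * (1 - p)) (p' * ?v) = ?v + ?x * decay ?x"
    using assms by (subst decay_eq) (auto simp: max_def algebra_simps)
  hence "optimal_step n p p' j ?v = (1 - 1 / j) * ?v + (?v + ?x * decay ?x) / j"
    by (simp add: optimal_step_def)
  also have "\<dots> = ?v + decay ?x / n"
    using assms by (simp add: field_simps)
  finally show ?thesis .
qed

abbreviation value_after :: "nat \<Rightarrow> nat \<Rightarrow> real" where
  "value_after n \<equiv> continuation (optimal_step n p p') n"

lemma limit_continuation_grid:
  fixes j n :: nat
  assumes "j < n"
  shows "limit_continuation (j / n) \<le> limit_continuation (Suc j / n) + decay (Suc j / n) / n"
    and "limit_continuation (Suc j / n) + decay (j / n) / n \<le> limit_continuation (j / n)"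
proof -
  have "real (Suc j) / n - j / n = 1 / n"
    by (simp add: diff_divide_distrib[symmetric])
  moreover have "real j / n \<le> real (Suc j) / n"
    by (rule divide_right_mono) auto
  ultimately show "limit_continuation (j / n) \<le> limit_continuation (Suc j / n) + decay (Suc j / n) / n"
    and "limit_continuation (Suc j / n) + decay (j / n) / n \<le> limit_continuation (j / n)"
    using secant_boundsD[OF limit_continuation_secant, of "j / n" "Suc j / n"] assms by auto
qed

text \<open>An Euler step backwards from the right end of a grid cell overshoots a concave function,
  and \<open>optimal_step\<close> is monotone.\<close>

lemma value_after_ge:
  assumes "j \<le> n" "1 \<le> n"
  shows "limit_continuation (j / n) \<le> value_after n j"
  using assms(1)
proof (induction rule: inc_induct)
  case base
  show ?case using assms by (simp add: limit_continuation_1)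
next
  case (step j)
  have "limit_continuation (j / n) \<le> optimal_step n p p' (Suc j) (limit_continuation (Suc j / n))"
    using limit_continuation_grid(1)[of j n] optimal_step_limit_continuation[of "Suc j" n] step by simp
  also have "\<dots> \<le> optimal_step n p p' (Suc j) (value_after n (Suc j))"
    using step by (intro optimal_step_mono) auto
  finally show ?case
    using step by (simp add: continuation_step)
qed

text \<open>The discretisation errors telescope because \<open>decay\<close> is monotone.\<close>

lemma value_after_le_decay:
  assumes "j \<le> n" "1 \<le> n"
  shows "value_after n j \<le> limit_continuation (j / n) + (1 - decay (j / n)) / n"
  using assms(1)
proof (induction rule: inc_induct)
  case base
  show ?case using assms by (simp add: limit_continuation_1 decay_1)
next
  case (step j)
  let ?x = "real (Suc j) / n"
  have "decay ?x \<le> decay 1"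
    using step by (intro secant_bounds_mono[OF limit_continuation_secant]) auto
  hence d: "0 \<le> (1 - decay ?x) / n"
    by (simp add: decay_1)
  have "value_after n j = optimal_step n p p' (Suc j) (value_after n (Suc j))"
    using step by (simp add: continuation_step)
  also have "\<dots> \<le> optimal_step n p p' (Suc j) (limit_continuation ?x + (1 - decay ?x) / n)"
    using step by (intro optimal_step_mono) auto
  also have "\<dots> \<le> optimal_step n p p' (Suc j) (limit_continuation ?x) + (1 - decay ?x) / n"
    using d by (intro optimal_step_add_le) auto
  \<comment> \<open>The Euler term \<open>decay ?x / n\<close> cancels against the error bound
    inherited from the right.\<close>
  also have "\<dots> = limit_continuation ?x + 1 / n"
    using step by (subst optimal_step_limit_continuation) (auto simp: diff_divide_distrib)
  also have "\<dots> \<le> limit_continuation (j / n) + (1 - decay (j / n)) / n"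
    using limit_continuation_grid(2)[of j n] step by (simp add: diff_divide_distrib)
  finally show ?case .
qed

lemma value_after_le:
  assumes "j \<le> n" "1 \<le> n"
  shows "value_after n j \<le> limit_continuation (j / n) + 1 / n"
proof -
  have "(1 - decay (j / n)) / n \<le> 1 / n"
    using decay_nonneg[of "j / n"] assms by (intro divide_right_mono) auto
  thus ?thesis
    using value_after_le_decay[OF assms] by linarith
qed

lemma value_after_antimono:
  assumes "i \<le> j" "j \<le> n"
  shows "value_after n j \<le> value_after n i"
  using assms(1)
proof (induction rule: inc_induct)
  case (step i)
  have "value_after n (Suc i) \<le> value_after n i"
    using step assms optimal_step_ge by (simp add: continuation_step)
  thus ?case
    using step by linarith
qed simp

section \<open>Optimal thresholds\<close>

lemma threshold_step_le:
  assumes "u \<le> w" "1 \<le> j"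
  shows "threshold_step t n p p' j u \<le> optimal_step n p p' j w"
proof -
  have "(1 - p') * u \<le> (1 - p') * w" "p' * u \<le> p' * w" "(1 - 1 / j) * u \<le> (1 - 1 / j) * w"
    using assms p'_le p'_pos by (auto intro!: mult_left_mono)
  thus ?thesis
    unfolding threshold_step_def optimal_step_def
    by (intro add_mono divide_right_mono) auto
qed

lemma threshold_continuation_le:
  "j \<le> n \<Longrightarrow> continuation (threshold_step t n p p') n j \<le> value_after n j"
  by (induction rule: inc_induct) (auto simp: continuation_step intro!: threshold_step_le)

text \<open>A sum of termwise bounded terms attains its bound only if every term does, so each
  decision is optimal. Equality \<open>u = w\<close> is read off from the factor
  \<open>j - 1\<close> or, if \<open>N\<close> is rejected, from \<open>p' > 0\<close>; the factor
  \<open>1 - p'\<close> may vanish.\<close>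

lemma threshold_step_eq_optimal_step:
  assumes eq: "threshold_step t n p p' j u = optimal_step n p p' j w" and "u \<le> w" "1 \<le> j"
  shows "t Y \<le> j \<Longrightarrow> (1 - p') * w \<le> j / n * p" and "j < t Y \<Longrightarrow> j / n * p \<le> (1 - p') * w"
    and "t N \<le> j \<Longrightarrow> p' * w \<le> j / n * (1 - p)" and "j < t N \<Longrightarrow> j / n * (1 - p) \<le> p' * w"
    and "2 \<le> j \<or> j < t N \<Longrightarrow> u = w"
proof -
  define a where "a = (if t Y \<le> j then j / n * p else (1 - p') * u)"
  define b where "b = (if t N \<le> j then j / n * (1 - p) else p' * u)"
  have q: "(1 - p') * u \<le> (1 - p') * w" and p': "p' * u \<le> p' * w"
    and u: "(real j - 1) * u \<le> (real j - 1) * w"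
    using assms p'_le p'_pos by (auto intro!: mult_left_mono)
  have a: "a \<le> max (j / n * p) ((1 - p') * w)" and b: "b \<le> max (j / n * (1 - p)) (p' * w)"
    using q p' by (auto simp: a_def b_def)
  have scale: "j * ((1 - 1 / j) * y + z / j) = (real j - 1) * y + z" for y z :: real
    using \<open>1 \<le> j\<close> by (simp add: field_simps)
  have "(real j - 1) * u + (a + b) =
      (real j - 1) * w + (max (j / n * p) ((1 - p') * w) + max (j / n * (1 - p)) (p' * w))"
    using arg_cong[OF eq, of "(*) (real j)"]
    unfolding threshold_step_def optimal_step_def a_def[symmetric] b_def[symmetric] scale .
  hence a': "a = max (j / n * p) ((1 - p') * w)" and b': "b = max (j / n * (1 - p)) (p' * w)"
    and u': "(real j - 1) * u = (real j - 1) * w"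
    using a b u by linarith+
  show "t Y \<le> j \<Longrightarrow> (1 - p') * w \<le> j / n * p" and "j < t Y \<Longrightarrow> j / n * p \<le> (1 - p') * w"
    using a' q unfolding a_def by (auto simp: max_def split: if_splits)
  show "t N \<le> j \<Longrightarrow> p' * w \<le> j / n * (1 - p)" and "j < t N \<Longrightarrow> j / n * (1 - p) \<le> p' * w"
    using b' p' unfolding b_def by (auto simp: max_def split: if_splits)
  assume "2 \<le> j \<or> j < t N"
  thus "u = w"
  proof
    assume "j < t N"
    hence "p' * w \<le> p' * u"
      using b' unfolding b_def by (auto simp: max_def split: if_splits)
    thus ?thesis
      using p'_pos \<open>u \<le> w\<close> by simp
  qed (use u' in auto)
qed

definition best_thresholds :: "nat \<Rightarrow> signal \<Rightarrow> nat" where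
  "best_thresholds n x = (case x of
     Y \<Rightarrow> (LEAST j. 1 \<le> j \<and> (1 - p') * value_after n j \<le> j / n * p)
   | N \<Rightarrow> (LEAST j. 1 \<le> j \<and> p' * value_after n j \<le> j / n * (1 - p)))"

text \<open>Time \<open>n\<close> qualifies because the value after it is \<open>0\<close>. The
  order of the thresholds follows from \<open>1 - p' \<le> p'\<close> and
  \<open>1 - p \<le> p\<close>: whenever accepting an \<open>N\<close> is right, so is accepting a
  \<open>Y\<close>.\<close>

lemma best_thresholds:
  assumes "1 \<le> n"
  defines "t \<equiv> best_thresholds n"
  shows "1 \<le> t Y \<and> (1 - p') * value_after n (t Y) \<le> t Y / n * p" "t Y \<le> n"
    and "1 \<le> t N \<and> p' * value_after n (t N) \<le> t N / n * (1 - p)" "t N \<le> n" "t Y \<le> t N"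
proof -
  let ?Y = "\<lambda>j. 1 \<le> j \<and> (1 - p') * value_after n j \<le> j / n * p"
  let ?N = "\<lambda>j. 1 \<le> j \<and> p' * value_after n j \<le> j / n * (1 - p)"
  have t: "t Y = (LEAST j. ?Y j)" "t N = (LEAST j. ?N j)"
    by (simp_all add: t_def best_thresholds_def)
  have n: "?Y n" "?N n"
    using assms p_pos p_le by auto
  show "?Y (t Y)" and N: "?N (t N)"
    unfolding t by (rule LeastI[of ?Y, OF n(1)], rule LeastI[of ?N, OF n(2)])
  show "t Y \<le> n" and "t N \<le> n"
    unfolding t by (rule Least_le, rule n)+
  have "?Y (t N)"
  proof
    have "value_after n (t N) \<ge> 0"
      using \<open>t N \<le> n\<close> p_pos p_le p'_pos p'_le by (intro continuation_optimal_nonneg) auto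
    hence "(1 - p') * value_after n (t N) \<le> p' * value_after n (t N)"
      using p'_ge by (intro mult_right_mono) auto
    also have "\<dots> \<le> t N / n * (1 - p)"
      using N by simp
    also have "\<dots> \<le> t N / n * p"
      using p_ge by (intro mult_left_mono) auto
    finally show "(1 - p') * value_after n (t N) \<le> t N / n * p" .
  qed (use N in simp)
  thus "t Y \<le> t N"
    unfolding t(1) by (rule Least_le)
qed

text \<open>Rewards increase and \<open>value_after\<close> decreases in time, so an acceptance
  inequality persists once it holds and the thresholds attain both maxima at every step.\<close>

lemma continuation_best_thresholds:
  assumes "j \<le> n" "1 \<le> n"
  shows "continuation (threshold_step (best_thresholds n) n p p') n j = value_after n j"
  using assms(1)
proof (induction rule: inc_induct)
  case (step j)
  let ?t = "best_thresholds n" and ?w = "value_after n (Suc j)"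
  note best = best_thresholds[OF assms(2)]
  have Y: "(1 - p') * ?w \<le> Suc j / n * p" if "?t Y \<le> Suc j"
  proof -
    have "(1 - p') * ?w \<le> (1 - p') * value_after n (?t Y)"
      using that step p'_le by (intro mult_left_mono value_after_antimono) auto
    also have "\<dots> \<le> ?t Y / n * p" using best by simp
    also have "\<dots> \<le> Suc j / n * p"
      using that p_pos by (intro mult_right_mono divide_right_mono) auto
    finally show ?thesis .
  qed
  have N: "p' * ?w \<le> Suc j / n * (1 - p)" if "?t N \<le> Suc j"
  proof -
    have "p' * ?w \<le> p' * value_after n (?t N)"
      using that step p'_pos by (intro mult_left_mono value_after_antimono) auto
    also have "\<dots> \<le> ?t N / n * (1 - p)" using best by simp
    also have "\<dots> \<le> Suc j / n * (1 - p)"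
      using that p_le by (intro mult_right_mono divide_right_mono) auto
    finally show ?thesis .
  qed
  have Y': "Suc j / n * p \<le> (1 - p') * ?w" if "Suc j < ?t Y"
    using not_less_Least[of "Suc j" "\<lambda>j. 1 \<le> j \<and> (1 - p') * value_after n j \<le> j / n * p"] that
    by (simp add: best_thresholds_def)
  have N': "Suc j / n * (1 - p) \<le> p' * ?w" if "Suc j < ?t N"
    using not_less_Least[of "Suc j" "\<lambda>j. 1 \<le> j \<and> p' * value_after n j \<le> j / n * (1 - p)"] that
    by (simp add: best_thresholds_def)
  have "threshold_step ?t n p p' (Suc j) ?w = optimal_step n p p' (Suc j) ?w"
    using Y N Y' N' unfolding threshold_step_def optimal_step_def
    by (auto simp: max_def not_le)
  thus ?case
    using step by (simp add: continuation_step)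
qed simp

lemma win_prob_best_thresholds:
  assumes "1 \<le> n"
  shows "win_prob n p p' (threshold_policy (best_thresholds n)) = value_after n 0"
  using assms p_pos p_le p'_pos p'_le continuation_best_thresholds[of 0 n]
  by (subst win_prob_threshold) auto

lemma win_prob_le_value_after:
  assumes "1 \<le> n"
  shows "win_prob n p p' \<pi> \<le> value_after n 0"
  using assms p_pos p_le p'_pos p'_le by (intro win_prob_le_optimal) auto

lemma optimal_best_thresholds:
  assumes "1 \<le> n"
  shows "optimal_thresholds n p p' (best_thresholds n)"
proof -
  have "best_thresholds n x \<in> {1..n}" for x
    using best_thresholds[OF assms] by (cases x) auto
  thus ?thesis
    using best_thresholds[OF assms] win_prob_best_thresholds[OF assms]
      win_prob_le_value_after[OF assms]
    unfolding optimal_thresholds_def optimal_policy_def by auto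
qed

lemma Opt_eq:
  assumes "1 \<le> n"
  shows "Opt n p p' = value_after n 0"
  unfolding Opt_def
proof (rule cSup_eq_maximum)
  show "value_after n 0 \<in> range (win_prob n p p')"
    using win_prob_best_thresholds[OF assms] by (metis rangeI)
qed (use win_prob_le_value_after[OF assms] in auto)

text \<open>Induction forwards: equality at time \<open>0\<close> forces equality at every later
  time that matters. At \<open>j = 1\<close> the factor \<open>1 - 1 / j\<close> vanishes; with
  \<open>t N = 1\<close> the policy stops at once and later values are unconstrained, hence
  \<open>1 < t N\<close>.\<close>

lemma optimal_thresholds_continuation:
  assumes opt: "optimal_thresholds n p p' t" and "1 \<le> n" "j < n" "j = 0 \<or> 1 < t N"
  shows "continuation (threshold_step t n p p') n j = value_after n j"
  using assms(3,4)
proof (induction j)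
  case 0
  have "win_prob n p p' (threshold_policy t) = value_after n 0"
    using opt win_prob_le_value_after[OF \<open>1 \<le> n\<close>] win_prob_best_thresholds[OF \<open>1 \<le> n\<close>]
    unfolding optimal_thresholds_def optimal_policy_def by (metis order.antisym)
  thus ?case
    using assms p_pos p_le p'_pos p'_le by (subst (asm) win_prob_threshold) auto
next
  case (Suc j)
  hence "threshold_step t n p p' (Suc j) (continuation (threshold_step t n p p') n (Suc j)) =
      optimal_step n p p' (Suc j) (value_after n (Suc j))"
    by (simp add: continuation_step)
  thus ?case
    by (rule threshold_step_eq_optimal_step(5)) (use Suc.prems threshold_continuation_le in auto)
qed

text \<open>From \<open>j \<le> t N\<close> it follows that \<open>j = 1\<close> or
  \<open>1 < t N\<close>, so \<open>optimal_thresholds_continuation\<close> applies at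
  \<open>j - 1\<close>.\<close>

lemma optimal_thresholds_indifference:
  assumes opt: "optimal_thresholds n p p' t" and "1 \<le> n" "1 \<le> j" "j \<le> n" "j \<le> t N"
  shows "t Y \<le> j \<Longrightarrow> (1 - p') * value_after n j \<le> j / n * p"
    and "j < t Y \<Longrightarrow> j / n * p \<le> (1 - p') * value_after n j"
    and "t N \<le> j \<Longrightarrow> p' * value_after n j \<le> j / n * (1 - p)"
    and "j < t N \<Longrightarrow> j / n * (1 - p) \<le> p' * value_after n j"
proof -
  obtain i where i: "j = Suc i" "i < n"
    using assms by (cases j) auto
  have "continuation (threshold_step t n p p') n i = value_after n i"
    using assms i by (intro optimal_thresholds_continuation[OF opt]) auto
  hence "threshold_step t n p p' j (continuation (threshold_step t n p p') n j) =
      optimal_step n p p' j (value_after n j)"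
    using i by (simp add: continuation_step)
  note * = threshold_step_eq_optimal_step[OF this threshold_continuation_le \<open>1 \<le> j\<close>]
  show "t Y \<le> j \<Longrightarrow> (1 - p') * value_after n j \<le> j / n * p"
    and "j < t Y \<Longrightarrow> j / n * p \<le> (1 - p') * value_after n j"
    and "t N \<le> j \<Longrightarrow> p' * value_after n j \<le> j / n * (1 - p)"
    and "j < t N \<Longrightarrow> j / n * (1 - p) \<le> p' * value_after n j"
    using *(1-4) assms by auto
qed

text \<open>The lower bound tests time \<open>t Y\<close>, the upper bound time
  \<open>t Y - 1\<close>. There the value error contributes \<open>(1 - p') / n \<le> p / n\<close>
  against slope \<open>p\<close>, hence \<open>1 / n\<close>; the shift by one step gives the other
  \<open>1 / n\<close>.\<close>

lemma optimal_threshold_yes_bounds: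
  assumes opt: "optimal_thresholds n p p' t" and "1 \<le> n"
  shows "yes_time \<le> t Y / n" "t Y / n \<le> yes_time + 2 / n"
proof -
  have t: "1 \<le> t Y" "t Y \<le> n" "t Y \<le> t N" "t N \<le> n"
    using opt unfolding optimal_thresholds_def by force+
  note ind = optimal_thresholds_indifference[OF opt \<open>1 \<le> n\<close>]
  show "yes_time \<le> t Y / n"
  proof (rule ccontr)
    let ?x = "real (t Y) / n"
    assume "\<not> yes_time \<le> ?x"
    hence "(1 - p') * limit_value = (1 - p') * limit_continuation ?x"
      by (simp add: limit_continuation_low)
    also have "\<dots> \<le> (1 - p') * value_after n (t Y)"
      using t p'_le \<open>1 \<le> n\<close> by (intro mult_left_mono value_after_ge) auto
    also have "\<dots> \<le> ?x * p"
      using ind(1)[of "t Y"] t by auto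
    finally have "p * yes_time \<le> p * ?x"
      unfolding limit_value_cross[symmetric] by (simp add: mult.commute)
    thus False
      using p_pos \<open>\<not> yes_time \<le> ?x\<close> mult_le_cancel_left_pos by blast
  qed
  show "t Y / n \<le> yes_time + 2 / n"
  proof (cases "t Y = 1")
    case True
    have "1 / real n \<le> 2 / n" by (intro divide_right_mono) auto
    thus ?thesis
      using True yes_time_nonneg by simp
  next
    case False
    define j where "j = t Y - 1"
    have j: "1 \<le> j" "j \<le> n" "t Y = Suc j"
      using False t by (auto simp: j_def)
    let ?x = "real j / n"
    have "?x * p \<le> (1 - p') * value_after n j"
      using ind(2)[of j] j t by auto
    also have "\<dots> \<le> (1 - p') * (limit_continuation ?x + 1 / n)"
      using j p'_le \<open>1 \<le> n\<close> by (intro mult_left_mono value_after_le) auto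
    also have "\<dots> \<le> (1 - p') * limit_continuation ?x + p * (1 / n)"
      using mult_right_mono[of "1 - p'" p "1 / n"] p_ge p'_ge by (simp add: distrib_left)
    finally have "p * (?x - yes_time) \<le> p * (1 / n)" if "yes_time \<le> ?x"
      using yes_cross_high[OF that] j \<open>1 \<le> n\<close> by simp
    hence "?x - yes_time \<le> 1 / n" if "yes_time \<le> ?x"
      using that p_pos mult_le_cancel_left_pos by blast
    moreover have "0 \<le> 1 / real n"
      by simp
    ultimately have "?x - yes_time \<le> 1 / n"
      by linarith
    thus ?thesis
      using j by (simp add: add_divide_distrib)
  qed
qed

text \<open>As for \<open>Y\<close>, but the error \<open>p' / n\<close> meets slope
  \<open>1 - p\<close>, so the constant depends on \<open>p\<close>.\<close>

lemma optimal_threshold_no_bounds: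
  assumes opt: "optimal_thresholds n p p' t" and "1 \<le> n"
  shows "no_time \<le> t N / n" "t N / n \<le> no_time + (1 + p' / (1 - p)) / n"
proof -
  have t: "1 \<le> t N" "t N \<le> n"
    using opt unfolding optimal_thresholds_def by force+
  note ind = optimal_thresholds_indifference[OF opt \<open>1 \<le> n\<close>]
  show "no_time \<le> t N / n"
  proof (rule ccontr)
    let ?x = "real (t N) / n"
    assume "\<not> no_time \<le> ?x"
    hence "?x * (1 - p) < p' * limit_continuation ?x"
      using t \<open>1 \<le> n\<close> by (intro no_cross_less) auto
    also have "\<dots> \<le> p' * value_after n (t N)"
      using t p'_pos \<open>1 \<le> n\<close> by (intro mult_left_mono value_after_ge) auto
    also have "\<dots> \<le> ?x * (1 - p)"
      using ind(3)[of "t N"] t by auto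
    finally show False by simp
  qed
  have pos: "0 \<le> p' / (1 - p)"
    using p'_pos p_le by simp
  show "t N / n \<le> no_time + (1 + p' / (1 - p)) / n"
  proof (cases "t N = 1 \<or> p = 1")
    \<comment> \<open>For \<open>p = 1\<close> the quotient \<open>p' / (1 - p)\<close> is
      \<open>0\<close> by convention, and \<open>no_time = 1\<close> bounds \<open>t N / n\<close>
      trivially.\<close>
    case True
    have le: "1 / real n \<le> (1 + p' / (1 - p)) / n"
      using pos by (intro divide_right_mono) auto
    have "t N / n \<le> 1"
      using t \<open>1 \<le> n\<close> by simp
    moreover have "no_time = 1" if "p = 1"
      using that unfolding no_time_def by simp
    ultimately show ?thesis
      using True le no_time_pos by (auto intro: order.trans)
  next
    case False
    define j where "j = t N - 1"
    have j: "1 \<le> j" "j \<le> n" "t N = Suc j"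
      using False t by (auto simp: j_def)
    let ?x = "real j / n"
    have "?x * (1 - p) \<le> p' * value_after n j"
      using ind(4)[of j] j t by auto
    also have "\<dots> \<le> p' * (limit_continuation ?x + 1 / n)"
      using j p'_pos \<open>1 \<le> n\<close> by (intro mult_left_mono value_after_le) auto
    finally have "(1 - p) * (?x - no_time) \<le> p' / n" if "no_time \<le> ?x"
      using no_cross_high[OF that] j \<open>1 \<le> n\<close> by (simp add: distrib_left)
    moreover have "(1 - p) * (p' / (1 - p) / n) = p' / n"
      using False by simp
    ultimately have "(1 - p) * (?x - no_time) \<le> (1 - p) * (p' / (1 - p) / n)" if "no_time \<le> ?x"
      using that by simp
    moreover have "0 < 1 - p"
      using False p_le by simp
    ultimately have "?x - no_time \<le> p' / (1 - p) / n" if "no_time \<le> ?x"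
      using that mult_le_cancel_left_pos by blast
    moreover have "0 \<le> p' / (1 - p) / n"
      using pos by (rule divide_nonneg_nonneg) simp
    ultimately have "?x - no_time \<le> p' / (1 - p) / n"
      by linarith
    thus ?thesis
      using j by (simp add: add_divide_distrib)
  qed
qed

section \<open>The limit of the optimal winning probability\<close>

lemma Opt_ge: "1 \<le> n \<Longrightarrow> limit_value \<le> Opt n p p'"
  using value_after_ge[of 0 n] limit_continuation_low[OF yes_time_nonneg] by (simp add: Opt_eq)

lemma tendsto_sandwich_over_n:
  fixes f :: "nat \<Rightarrow> real"
  assumes "\<And>n. 1 \<le> n \<Longrightarrow> l \<le> f n" "\<And>n. 1 \<le> n \<Longrightarrow> f n \<le> l + c / n"
  shows "f \<longlonglongrightarrow> l"
proof (rule tendsto_sandwich[OF _ _ tendsto_const])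
  show "(\<lambda>n. l + c / real n) \<longlonglongrightarrow> l"
    using tendsto_add[OF tendsto_const[of l] lim_const_over_n[of c]] by simp
qed (use assms in \<open>auto intro!: eventually_sequentiallyI[of 1]\<close>)

lemma Opt_tendsto: "(\<lambda>n. Opt n p p') \<longlonglongrightarrow> limit_value"
proof (rule tendsto_sandwich_over_n)
  show "Opt n p p' \<le> limit_value + 1 / n" if "1 \<le> n" for n
    using value_after_le[of 0 n] limit_continuation_low[OF yes_time_nonneg] that by (simp add: Opt_eq)
qed (rule Opt_ge)

lemma OPT_ge: "limit_value \<le> OPT p p'"
  unfolding OPT_def using Opt_ge by (intro cINF_greatest) auto

end

theorem theorem5:
  fixes p p' :: real
  assumes "1/2 \<le> p" "p \<le> 1" "1/2 \<le> p'" "p' \<le> 1"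
  shows "(\<forall>n\<ge>1. \<exists>t. optimal_thresholds n p p' t)
    \<and> OPT p p' \<ge> lim (\<lambda>n. Opt n p p')
    \<and> (\<lambda>n. Opt n p p') \<longlonglongrightarrow> rpow ((1 - p') / p) ((1 - p') / p') * exp (p / p' - 1 / p')
    \<and> (\<forall>t :: nat \<Rightarrow> signal \<Rightarrow> nat. (\<forall>n\<ge>1. optimal_thresholds n p p' (t n)) \<longrightarrow>
          (\<lambda>n. real (t n Y) / real n) \<longlonglongrightarrow> rpow ((1 - p') / p) (1 / p') * exp (p / p' - 1 / p')
        \<and> (\<lambda>n. real (t n N) / real n) \<longlonglongrightarrow> exp (p / p' - 1 / p'))"
proof -
  interpret binary_classifier p p'
    using assms by unfold_locales
  have "(\<lambda>n. real (t n Y) / real n) \<longlonglongrightarrow> yes_time \<and> (\<lambda>n. real (t n N) / real n) \<longlonglongrightarrow> no_time"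
    if "\<forall>n\<ge>1. optimal_thresholds n p p' (t n)" for t
    using that
    by (intro conjI tendsto_sandwich_over_n[where c = 2]
          tendsto_sandwich_over_n[where c = "1 + p' / (1 - p)"]
          optimal_threshold_yes_bounds optimal_threshold_no_bounds) auto
  \<comment> \<open>Convergence identifies \<open>lim\<close> with \<open>limit_value\<close>, so
    the bound on \<open>OPT\<close> becomes \<open>OPT_ge\<close>.\<close>
  thus ?thesis
    using optimal_best_thresholds OPT_ge Opt_tendsto limI[OF Opt_tendsto]
    unfolding yes_time_def no_time_def limit_value_def by auto
qed

end
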